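(* Let $\mathcal{A}$ be a totally coprime cluster algebra with upper cluster algebra $\mathcal{U}$, and let $S=L_{\mathbf{x}}$ be the lower bound of some seed $(\mathbf{x},B)$ of $\mathcal{A}$. Let $f=x_1x_2\cdots x_m$ be the product of the mutable variables of $\mathbf{x}$, put $S_1:=S$, and inductively let $S_{i+1}$ be the sub-$\mathbb{ZP}$-algebra of $\mathbb{Q}(x_1,\dots,x_n)$ generated by $S_i$ and $(S_if:(S_i\mathbb{D}_{\mathbf{x}})^\infty)f^{-1}$. If $\mathcal{U}$ is finitely generated, then $\mathcal{U}=S_i$ for some $i$.
   Context: Seeds. Let $n\ge m\ge 0$ be integers. A matrix $M\in \mathrm{Mat}_{m,m}(\mathbb{Z})$ is skew-symmetrizable if there is a diagonal integer matrix $D$ with positive diagonal entries such that $DM$ is skew-symmetric. An ordered seed is a pair $(\mathbf{x},B)$ where $B\in \mathrm{Mat}_{n,m}(\mathbb{Z})$ has skew-symmetrizable principal part (the top $m\times m$ submatrix), and $\mathbf{x}=(x_1,\dots,x_n)$ is an $n$-tuple of elements of a field $\mathcal{F}$ of characteristic zero which freely generates $\mathcal{F}$ as a field over $\mathbb{Q}$. The variable $x_i$ is mutable if $1\le i\le m$ and frozen if $m<i\le n$. Mutation. For $1\le k\le m$ the mutation of $(\mathbf{x},B)$ at $k$ is the ordered seed $(\mathbf{x}',B')$ with $x_i'=x_i$ for $i\neq k$, $x_k'=\left(\prod_{B_{jk}>0}x_j^{B_{jk}}+\prod_{B_{jk}<0}x_j^{-B_{jk}}\right)x_k^{-1}$,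 and $B'_{ij}=-B_{ij}$ if $i=k$ or $j=k$, $B'_{ij}=B_{ij}+\frac{|B_{ik}|B_{kj}+B_{ik}|B_{kj}|}{2}$ otherwise. Two ordered seeds are mutation-equivalent if one is obtained from the other by a sequence of mutations and of permutations of the indices preserving $\{1,\dots,m\}$ (acting simultaneously on $\mathbf{x}$ and on the rows and columns of $B$). Algebras. The cluster algebra $\mathcal{A}=\mathcal{A}(\mathbf{x},B)$ is the subring of $\mathcal{F}$ generated by all entries of $\mathbf{y}$ for all $(\mathbf{y},C)$ mutation-equivalent to $(\mathbf{x},B)$, together with the inverses of the frozen variables; these $(\mathbf{y},C)$ are the seeds of $\mathcal{A}$ and the sets of entries of the $\mathbf{y}$ are its clusters. The upper cluster algebra is $\mathcal{U}=\bigcap_{\text{clusters }\{x_1,\dots,x_n\}}\mathbb{Z}[x_1^{\pm1},\dots,x_n^{\pm1}]\subset\mathcal{F}$. A seed is coprime if every pair of columns of its exchange matrix is linearly independent; $\mathcal{A}$ is totally coprime if every seed of $\mathcal{A}$ is coprime. For a fixed seed $(\mathbf{x},B)$, let $x_i'$ ($1\le i\le m$) denote the new variable obtained by mutating $(\mathbf{x},B)$ at $i$. The lower bound $L_{\mathbf{x}}$ is the subring of $\mathcal{F}$ generated by $x_1,\dots,x_n,x_1',\dots,x_m',x_{m+1}^{-1},\dots,x_n^{-1}$. The lower deep ideal is the $L_{\mathbf{x}}$-ideal $\mathbb{D}_{\mathbf{x}}=L_{\mathbf{x}}(x_1\cdots x_m)+\sum_{i=1}^m L_{\mathbf{x}}(x_1\cdots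 x_{i-1}x_i'x_{i+1}\cdots x_m)$; $S_i\mathbb{D}_{\mathbf{x}}$ is the ideal it generates in $S_i$. The coefficient ring is $\mathbb{ZP}=\mathbb{Z}[x_{m+1}^{\pm1},\dots,x_n^{\pm1}]$. Saturation. For ideals $I,J$ of a ring $R$, $(J:I^\infty)=\{r\in R\mid \forall g\in I,\ \exists k\in\mathbb{N}\text{ such that } rg^k\in J\}$. *)

theory Defs
  imports Complex_Main "HOL-Library.Poly_Mapping" "HOL-Combinatorics.Permutations"
begin

text \<open>
  The ambient field is the type \<open>'a :: field_char_0\<close>; subrings, subfields and
  ideals are sets. Indices run from 1: an ordered seed with \<open>n\<close> variables, \<open>m\<close> of
  them mutable, is given by \<open>x i\<close> for \<open>1 \<le> i \<le> n\<close> and \<open>B i j\<close> for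
  \<open>1 \<le> i \<le> n\<close>, \<open>1 \<le> j \<le> m\<close>. Values at other indices are irrelevant: nothing
  below reads them in computing the values at these indices.
\<close>

type_synonym 'a seed = "(nat \<Rightarrow> 'a) \<times> (nat \<Rightarrow> nat \<Rightarrow> int)"

definition is_subring :: "'a::comm_ring_1 set \<Rightarrow> bool" where
  "is_subring R \<longleftrightarrow> 0 \<in> R \<and> 1 \<in> R \<and>
     (\<forall>a\<in>R. \<forall>b\<in>R. a + b \<in> R \<and> a * b \<in> R) \<and> (\<forall>a\<in>R. - a \<in> R)"

definition is_subfield :: "'a::field set \<Rightarrow> bool" where
  "is_subfield K \<longleftrightarrow> is_subring K \<and> (\<forall>a\<in>K. inverse a \<in> K)"

definition is_ideal :: "'a::comm_ring_1 set \<Rightarrow> 'a set \<Rightarrow> bool" where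
  "is_ideal R I \<longleftrightarrow> I \<subseteq> R \<and> 0 \<in> I \<and>
     (\<forall>a\<in>I. \<forall>b\<in>I. a + b \<in> I) \<and> (\<forall>r\<in>R. \<forall>a\<in>I. r * a \<in> I)"

definition fin_gen_ring :: "'a::comm_ring_1 set \<Rightarrow> bool" where
  "fin_gen_ring R \<longleftrightarrow> (\<exists>G. finite G \<and> R = is_subring hull G)"

text \<open>\<open>saturation R J I\<close> is $(J : I^\infty)$ in the ring \<open>R\<close>.\<close>

definition saturation :: "'a::comm_ring_1 set \<Rightarrow> 'a set \<Rightarrow> 'a set \<Rightarrow> 'a set" where
  "saturation R J I = {r \<in> R. \<forall>g\<in>I. \<exists>k::nat. r * g ^ k \<in> J}"

text \<open>
  A polynomial over the rationals in variables indexed by \<open>nat\<close> is a finitely supported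
  map from monomials (finitely supported exponent vectors) to coefficients.
\<close>

definition poly_eval :: "(nat \<Rightarrow> 'a::field_char_0) \<Rightarrow> ((nat \<Rightarrow>\<^sub>0 nat) \<Rightarrow>\<^sub>0 rat) \<Rightarrow> 'a" where
  "poly_eval x p = (\<Sum>e\<in>Poly_Mapping.keys p. of_rat (Poly_Mapping.lookup p e) *
     (\<Prod>i\<in>Poly_Mapping.keys e. x i ^ Poly_Mapping.lookup e i))"

definition algebraically_independent :: "nat \<Rightarrow> (nat \<Rightarrow> 'a::field_char_0) \<Rightarrow> bool" where
  "algebraically_independent n x \<longleftrightarrow>
     (\<forall>p. (\<forall>e\<in>Poly_Mapping.keys p. Poly_Mapping.keys e \<subseteq> {1..n}) \<longrightarrow>
        poly_eval x p = 0 \<longrightarrow> p = 0)"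

text \<open>Every subfield contains the rationals, so the second conjunct is generation over them.\<close>

definition freely_generates_field :: "nat \<Rightarrow> (nat \<Rightarrow> 'a::field_char_0) \<Rightarrow> bool" where
  "freely_generates_field n x \<longleftrightarrow>
     algebraically_independent n x \<and> is_subfield hull (x ` {1..n}) = UNIV"

definition skew_symmetrizable :: "nat \<Rightarrow> (nat \<Rightarrow> nat \<Rightarrow> int) \<Rightarrow> bool" where
  "skew_symmetrizable m M \<longleftrightarrow>
     (\<exists>d :: nat \<Rightarrow> int. (\<forall>i\<in>{1..m}. d i > 0) \<and>
        (\<forall>i\<in>{1..m}. \<forall>j\<in>{1..m}. d i * M i j = - (d j * M j i)))"

definition ordered_seed :: "nat \<Rightarrow> nat \<Rightarrow> 'a::field_char_0 seed \<Rightarrow> bool" where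
  "ordered_seed n m = (\<lambda>(x, B). skew_symmetrizable m B \<and> freely_generates_field n x)"

definition exchanged_var ::
    "nat \<Rightarrow> (nat \<Rightarrow> 'a::field) \<Rightarrow> (nat \<Rightarrow> nat \<Rightarrow> int) \<Rightarrow> nat \<Rightarrow> 'a" where
  "exchanged_var n x B k =
     ((\<Prod>j | j \<in> {1..n} \<and> B j k > 0. x j ^ nat (B j k)) +
      (\<Prod>j | j \<in> {1..n} \<and> B j k < 0. x j ^ nat (- B j k))) * inverse (x k)"

text \<open>The division by 2 is exact, the numerator being 0 or twice a product of two entries.\<close>

definition mutate_matrix ::
    "nat \<Rightarrow> (nat \<Rightarrow> nat \<Rightarrow> int) \<Rightarrow> (nat \<Rightarrow> nat \<Rightarrow> int)" where
  "mutate_matrix k B = (\<lambda>i j. if i = k \<or> j = k then - B i j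
     else B i j + (\<bar>B i k\<bar> * B k j + B i k * \<bar>B k j\<bar>) div 2)"

definition mutate :: "nat \<Rightarrow> nat \<Rightarrow> 'a::field seed \<Rightarrow> 'a seed" where
  "mutate n k = (\<lambda>(x, B). (x(k := exchanged_var n x B k), mutate_matrix k B))"

definition permute_seed :: "(nat \<Rightarrow> nat) \<Rightarrow> 'a seed \<Rightarrow> 'a seed" where
  "permute_seed \<sigma> = (\<lambda>(x, B). (\<lambda>i. x (\<sigma> i), \<lambda>i j. B (\<sigma> i) (\<sigma> j)))"

inductive seed_step :: "nat \<Rightarrow> nat \<Rightarrow> 'a::field seed \<Rightarrow> 'a seed \<Rightarrow> bool" for n m where
  mutation: "k \<in> {1..m} \<Longrightarrow> seed_step n m s (mutate n k s)"
| permutation: "\<sigma> permutes {1..n} \<Longrightarrow> \<sigma> ` {1..m} = {1..m} \<Longrightarrow>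
    seed_step n m s (permute_seed \<sigma> s)"

definition mutation_equivalent :: "nat \<Rightarrow> nat \<Rightarrow> 'a::field seed \<Rightarrow> 'a seed \<Rightarrow> bool" where
  "mutation_equivalent n m = (seed_step n m)\<^sup>*\<^sup>*"

text \<open>
  A cluster algebra is presented by one of its seeds \<open>s\<close>; its seeds are then those
  mutation-equivalent to \<open>s\<close>.
\<close>

definition seeds_of :: "nat \<Rightarrow> nat \<Rightarrow> 'a::field seed \<Rightarrow> 'a seed set" where
  "seeds_of n m s = {t. mutation_equivalent n m s t}"

definition cluster_algebra :: "nat \<Rightarrow> nat \<Rightarrow> 'a::field seed \<Rightarrow> 'a set" where
  "cluster_algebra n m s = is_subring hull
     ((\<Union>(y, C)\<in>seeds_of n m s. y ` {1..n}) \<union> (\<lambda>i. inverse (fst s i)) ` {m<..n})"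

definition laurent_ring :: "nat \<Rightarrow> (nat \<Rightarrow> 'a::field) \<Rightarrow> 'a set" where
  "laurent_ring n y = is_subring hull (y ` {1..n} \<union> (\<lambda>i. inverse (y i)) ` {1..n})"

definition upper_cluster_algebra :: "nat \<Rightarrow> nat \<Rightarrow> 'a::field seed \<Rightarrow> 'a set" where
  "upper_cluster_algebra n m s = (\<Inter>(y, C)\<in>seeds_of n m s. laurent_ring n y)"

text \<open>Pairs of columns are pairs of columns at distinct positions.\<close>

definition coprime_seed :: "nat \<Rightarrow> nat \<Rightarrow> 'a seed \<Rightarrow> bool" where
  "coprime_seed n m = (\<lambda>(x, B). \<forall>i\<in>{1..m}. \<forall>j\<in>{1..m}. i \<noteq> j \<longrightarrow>
     (\<forall>a b :: rat. (\<forall>k\<in>{1..n}. a * of_int (B k i) + b * of_int (B k j) = 0) \<longrightarrow>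
        a = 0 \<and> b = 0))"

definition totally_coprime :: "nat \<Rightarrow> nat \<Rightarrow> 'a::field seed \<Rightarrow> bool" where
  "totally_coprime n m s \<longleftrightarrow> (\<forall>t\<in>seeds_of n m s. coprime_seed n m t)"

definition coeff_ring :: "nat \<Rightarrow> nat \<Rightarrow> (nat \<Rightarrow> 'a::field) \<Rightarrow> 'a set" where
  "coeff_ring n m x = is_subring hull (x ` {m<..n} \<union> (\<lambda>i. inverse (x i)) ` {m<..n})"

definition lower_bound :: "nat \<Rightarrow> nat \<Rightarrow> 'a::field seed \<Rightarrow> 'a set" where
  "lower_bound n m = (\<lambda>(x, B). is_subring hull
     (x ` {1..n} \<union> exchanged_var n x B ` {1..m} \<union> (\<lambda>i. inverse (x i)) ` {m<..n}))"

definition mutable_prod :: "nat \<Rightarrow> 'a::field seed \<Rightarrow> 'a" where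
  "mutable_prod m = (\<lambda>(x, B). \<Prod>i\<in>{1..m}. x i)"

definition lower_deep_ideal :: "nat \<Rightarrow> nat \<Rightarrow> 'a::field seed \<Rightarrow> 'a set" where
  "lower_deep_ideal n m = (\<lambda>(x, B).
     {a * mutable_prod m (x, B) +
        (\<Sum>i\<in>{1..m}. c i * (exchanged_var n x B i * (\<Prod>j\<in>{1..m} - {i}. x j))) | a c.
      a \<in> lower_bound n m (x, B) \<and> (\<forall>i\<in>{1..m}. c i \<in> lower_bound n m (x, B))})"

text \<open>
  \<open>deep_extension n m t S\<close> is the subalgebra over the coefficient ring generated by \<open>S\<close> and
  $(Sf : (S\mathbb{D})^\infty) f^{-1}$, where $f$ is the product of the mutable variables and
  $\mathbb{D}$ the lower deep ideal of the seed \<open>t\<close>.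
\<close>

definition deep_extension :: "nat \<Rightarrow> nat \<Rightarrow> 'a::field seed \<Rightarrow> 'a set \<Rightarrow> 'a set" where
  "deep_extension n m t S =
     (let f = mutable_prod m t;
          Sf = (\<lambda>s. s * f) ` S;
          SD = is_ideal S hull lower_deep_ideal n m t
      in is_subring hull
           (coeff_ring n m (fst t) \<union> S \<union> (\<lambda>r. r * inverse f) ` saturation S Sf SD))"

end

theory Submission
  imports Defs "HOL-Computational_Algebra.Polynomial"
begin

text \<open>
  Let \<open>UB(\<^bold>x)\<close> be the set of elements that are Laurent polynomials in the cluster \<open>\<^bold>x\<close> and in each of
  its one-step mutations. If all seeds are coprime, \<open>UB\<close> does not change under mutation: an element
  \<open>u\<close> of \<open>UB(\<^bold>x)\<close> is also a Laurent polynomial after the mutations at \<open>k\<close> and then at \<open>j\<close>, because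
  the denominators of \<open>u\<close> (the \<open>g\<close> with \<open>u g\<^sup>N\<close> in that Laurent ring for some \<open>N\<close>) form an ideal
  which contains the binomial \<open>P\<^sub>k\<close> and a second element coprime to it. Hence \<open>U = UB(\<^bold>x)\<close> for
  every seed. If \<open>r = u f\<close> lies in the saturation, then \<open>u\<close> times powers of the generators of the deep
  ideal lies in \<open>U\<close>; these generators are units in the Laurent rings defining \<open>UB(\<^bold>x)\<close>, so
  \<open>u \<in> U\<close> and all \<open>S\<^sub>i\<close> are contained in \<open>U\<close>. Conversely, for \<open>u \<in> U\<close> the deep ideal
  consists of denominators of \<open>u\<close> over \<open>S\<^sub>1\<close>, so \<open>u f\<^sup>j\<^sup>+\<^sup>1 \<in> S\<^sub>i\<close> implies \<open>u f\<^sup>j \<in> S\<^sub>i\<^sub>+\<^sub>1\<close>, and \<open>u\<close>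
  lies in some \<open>S\<^sub>i\<close>. The \<open>S\<^sub>i\<close> increase, so one of them contains a finite generating set of \<open>U\<close>.
\<close>

subsection \<open>Subrings and adjoining an invertible element\<close>

lemma is_subring_hull: "is_subring (is_subring hull A)"
  by (rule hull_in) (auto simp: is_subring_def)

lemma is_subringI:
  assumes "0 \<in> R" "1 \<in> R" "\<And>a b. a \<in> R \<Longrightarrow> b \<in> R \<Longrightarrow> a + b \<in> R"
    "\<And>a b. a \<in> R \<Longrightarrow> b \<in> R \<Longrightarrow> a * b \<in> R" "\<And>a. a \<in> R \<Longrightarrow> - a \<in> R"
  shows "is_subring R"
  using assms by (auto simp: is_subring_def)

lemma subring_closed:
  assumes "is_subring R"
  shows "0 \<in> R" "1 \<in> R" "a \<in> R \<Longrightarrow> b \<in> R \<Longrightarrow> a + b \<in> R"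
    "a \<in> R \<Longrightarrow> b \<in> R \<Longrightarrow> a * b \<in> R" "a \<in> R \<Longrightarrow> - a \<in> R"
    "a \<in> R \<Longrightarrow> b \<in> R \<Longrightarrow> a - b \<in> R" "a \<in> R \<Longrightarrow> a ^ k \<in> R"
proof -
  show "0 \<in> R" "1 \<in> R" using assms by (auto simp: is_subring_def)
  show add: "a \<in> R \<Longrightarrow> b \<in> R \<Longrightarrow> a + b \<in> R" for a b
    using assms by (auto simp: is_subring_def)
  show mult: "a \<in> R \<Longrightarrow> b \<in> R \<Longrightarrow> a * b \<in> R" for a b
    using assms by (auto simp: is_subring_def)
  show minus: "a \<in> R \<Longrightarrow> - a \<in> R" for a using assms by (auto simp: is_subring_def)
  show "a \<in> R \<Longrightarrow> b \<in> R \<Longrightarrow> a - b \<in> R" using add[OF _ minus, of a b] by simp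
  show "a \<in> R \<Longrightarrow> a ^ k \<in> R" by (induction k) (auto intro: mult \<open>1 \<in> R\<close>)
qed

lemma subring_sum: "is_subring R \<Longrightarrow> (\<And>i. i \<in> A \<Longrightarrow> f i \<in> R) \<Longrightarrow> sum f A \<in> R"
  by (induction A rule: infinite_finite_induct) (auto simp: subring_closed)

lemma subring_prod: "is_subring R \<Longrightarrow> (\<And>i. i \<in> A \<Longrightarrow> f i \<in> R) \<Longrightarrow> prod f A \<in> R"
  by (induction A rule: infinite_finite_induct) (auto simp: subring_closed)

section \<open>Polynomials and Laurent polynomials in one element over a subring\<close>

definition polys_over :: "'a::comm_ring_1 set \<Rightarrow> 'a poly set" where
  "polys_over K = {p. \<forall>i. coeff p i \<in> K}"

lemma polys_overD: "p \<in> polys_over K \<Longrightarrow> coeff p i \<in> K"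
  by (simp add: polys_over_def)

lemma is_subring_polys_over: "is_subring K \<Longrightarrow> is_subring (polys_over K)"
  unfolding is_subring_def[of "polys_over K"]
  by (auto simp: polys_over_def coeff_mult coeff_1 subring_closed intro!: subring_sum)

lemma polys_over_monom: "is_subring K \<Longrightarrow> c \<in> K \<Longrightarrow> monom c k \<in> polys_over K"
  by (auto simp: polys_over_def subring_closed)

lemma poly_in_subring:
  assumes "is_subring S" "K \<subseteq> S" "p \<in> polys_over K" "w \<in> S"
  shows "poly p w \<in> S"
  unfolding poly_altdef using assms
  by (intro subring_sum subring_closed(4,7)) (auto simp: polys_over_def)

text \<open>For a subring \<open>K\<close> and nonzero \<open>w\<close> this is the ring generated
  by \<open>K\<close>, \<open>w\<close> and \<open>inverse w\<close>. Writing each element as one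
  polynomial over one power of \<open>w\<close> reduces later arguments to comparing
  coefficients.\<close>

definition laurent_adj :: "'a::field set \<Rightarrow> 'a \<Rightarrow> 'a set" where
  "laurent_adj K w = {u. \<exists>N. \<exists>p\<in>polys_over K. u * w ^ N = poly p w}"

lemma laurent_adjI: "p \<in> polys_over K \<Longrightarrow> u * w ^ N = poly p w \<Longrightarrow> u \<in> laurent_adj K w"
  by (auto simp: laurent_adj_def)

lemma poly_in_laurent_adj: "p \<in> polys_over K \<Longrightarrow> poly p w \<in> laurent_adj K w"
  by (rule laurent_adjI[of _ _ _ _ 0]) simp_all

lemma is_subring_laurent_adj:
  assumes K: "is_subring K"
  shows "is_subring (laurent_adj K w)"
proof -
  note P = subring_closed[OF is_subring_polys_over[OF K]]
  have X: "monom 1 N \<in> polys_over K" for N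
    using K by (simp add: polys_over_monom subring_closed)
  have "a + b \<in> laurent_adj K w \<and> a * b \<in> laurent_adj K w"
    if ab: "a \<in> laurent_adj K w" "b \<in> laurent_adj K w" for a b
  proof -
    obtain N p where p: "p \<in> polys_over K" "a * w ^ N = poly p w"
      using ab(1) by (auto simp: laurent_adj_def)
    obtain M q where q: "q \<in> polys_over K" "b * w ^ M = poly q w"
      using ab(2) by (auto simp: laurent_adj_def)
    have "(a + b) * w ^ (N + M) = (a * w ^ N) * w ^ M + (b * w ^ M) * w ^ N"
      by (simp add: algebra_simps power_add)
    also have "\<dots> = poly (p * monom 1 M + q * monom 1 N) w"
      by (simp add: p q poly_monom)
    finally have 1: "a + b \<in> laurent_adj K w"
      using P(3)[OF P(4)[OF p(1) X] P(4)[OF q(1) X]] by (rule laurent_adjI[rotated])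
    have "a * b * w ^ (N + M) = (a * w ^ N) * (b * w ^ M)"
      by (simp add: algebra_simps power_add)
    also have "\<dots> = poly (p * q) w" by (simp add: p q)
    finally have "a * b \<in> laurent_adj K w" using P(4)[OF p(1) q(1)] by (rule laurent_adjI[rotated])
    thus ?thesis using 1 by blast
  qed
  moreover have "- a \<in> laurent_adj K w" if a: "a \<in> laurent_adj K w" for a
  proof -
    obtain N p where p: "p \<in> polys_over K" "a * w ^ N = poly p w"
      using a by (auto simp: laurent_adj_def)
    thus ?thesis by (intro laurent_adjI[OF P(5)[OF p(1)], of _ _ N]) simp
  qed
  moreover have "0 \<in> laurent_adj K w" "1 \<in> laurent_adj K w"
    using poly_in_laurent_adj[OF P(1), of w] poly_in_laurent_adj[OF P(2), of w] by simp_all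
  ultimately show ?thesis by (auto simp: is_subring_def)
qed

lemma laurent_adj_contains:
  assumes K: "is_subring K"
  shows "K \<subseteq> laurent_adj K w" "w \<in> laurent_adj K w" "w \<noteq> 0 \<Longrightarrow> inverse w \<in> laurent_adj K w"
proof -
  show "K \<subseteq> laurent_adj K w"
    using poly_in_laurent_adj[OF polys_over_monom[OF K], of _ 0 w] by (auto simp: poly_monom)
  show "w \<in> laurent_adj K w"
    using poly_in_laurent_adj[OF polys_over_monom[OF K], of 1 1 w] K
    by (auto simp: poly_monom subring_closed)
  show "inverse w \<in> laurent_adj K w" if "w \<noteq> 0"
    using that by (intro laurent_adjI[OF subring_closed(2)[OF is_subring_polys_over[OF K]], of _ _ 1]) simp
qed

lemma laurent_adj_subset:
  assumes "is_subring S" "K \<subseteq> S" "w \<in> S" "inverse w \<in> S" "w \<noteq> 0"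
  shows "laurent_adj K w \<subseteq> S"
proof
  fix u assume "u \<in> laurent_adj K w"
  then obtain N p where p: "p \<in> polys_over K" "u * w ^ N = poly p w"
    by (auto simp: laurent_adj_def)
  have "u = poly p w * inverse w ^ N"
    using p(2) assms(5) by (simp add: field_simps)
  thus "u \<in> S" using poly_in_subring[OF assms(1,2) p(1) assms(3)] assms by (simp add: subring_closed)
qed

section \<open>Laurent polynomial rings in several variables\<close>

definition laurent_on :: "nat set \<Rightarrow> (nat \<Rightarrow> 'a::field) \<Rightarrow> 'a set" where
  "laurent_on I x = is_subring hull (x ` I \<union> (\<lambda>i. inverse (x i)) ` I)"

lemma laurent_ring_eq: "laurent_ring n = laurent_on {1..n}"
  by (simp add: fun_eq_iff laurent_ring_def laurent_on_def)

lemma is_subring_laurent_on: "is_subring (laurent_on I x)"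
  unfolding laurent_on_def by (rule is_subring_hull)

lemmas laurent_on_closed = subring_closed[OF is_subring_laurent_on]

lemma laurent_on_gen: "i \<in> I \<Longrightarrow> x i \<in> laurent_on I x" "i \<in> I \<Longrightarrow> inverse (x i) \<in> laurent_on I x"
  by (auto simp: laurent_on_def intro!: hull_inc)

lemma laurent_on_least:
  assumes "is_subring S" "\<And>i. i \<in> I \<Longrightarrow> x i \<in> S" "\<And>i. i \<in> I \<Longrightarrow> inverse (x i) \<in> S"
  shows "laurent_on I x \<subseteq> S"
  unfolding laurent_on_def using assms by (intro hull_minimal) auto

lemma laurent_on_mono: "I \<subseteq> J \<Longrightarrow> laurent_on I x \<subseteq> laurent_on J x"
  by (intro laurent_on_least is_subring_laurent_on laurent_on_gen) auto

lemma laurent_on_cong: "(\<And>i. i \<in> I \<Longrightarrow> x i = y i) \<Longrightarrow> laurent_on I x = laurent_on I y"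
  by (simp add: laurent_on_def)

lemma laurent_on_reindex:
  assumes "\<sigma> ` I = J" shows "laurent_on I (\<lambda>i. x (\<sigma> i)) = laurent_on J x"
  unfolding laurent_on_def assms[symmetric] by (simp add: image_image)

text \<open>Singling out one variable makes coefficient comparison in that variable available for
  the multivariate rings.\<close>

lemma laurent_on_insert:
  assumes "x p \<noteq> 0"
  shows "laurent_on (insert p I) x = laurent_adj (laurent_on I x) (x p)"
proof
  note S = is_subring_laurent_adj[OF is_subring_laurent_on[of I x], of "x p"]
  note C = laurent_adj_contains[OF is_subring_laurent_on[of I x], of "x p"]
  show "laurent_on (insert p I) x \<subseteq> laurent_adj (laurent_on I x) (x p)"
    by (rule laurent_on_least[OF S]) (use C laurent_on_gen[of _ I x] assms in auto)
  show "laurent_adj (laurent_on I x) (x p) \<subseteq> laurent_on (insert p I) x"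
    by (intro laurent_adj_subset is_subring_laurent_on laurent_on_gen laurent_on_mono assms) auto
qed

lemma laurent_on_remove:
  assumes "p \<in> I" "x p \<noteq> 0"
  shows "laurent_on I x = laurent_adj (laurent_on (I - {p}) x) (x p)"
  using laurent_on_insert[of x p "I - {p}"] assms by (simp add: insert_absorb)

subsection \<open>Denominators\<close>

text \<open>For a subring \<open>S\<close> this is the radical of the ideal of all \<open>g\<close>
  in \<open>S\<close> with \<open>u * g\<close> in \<open>S\<close>.\<close>

definition denominators :: "'a::comm_ring_1 set \<Rightarrow> 'a \<Rightarrow> 'a set" where
  "denominators S u = {g \<in> S. \<exists>k. u * g ^ k \<in> S}"

lemma denominators_mult:
  assumes S: "is_subring S" and g: "g \<in> denominators S u" and h: "h \<in> S"
  shows "h * g \<in> denominators S u"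
proof -
  obtain k where k: "u * g ^ k \<in> S" using g by (auto simp: denominators_def)
  have "u * (h * g) ^ k = (u * g ^ k) * h ^ k" by (simp add: power_mult_distrib)
  thus ?thesis using k g h S by (auto simp: denominators_def subring_closed intro!: exI[of _ k])
qed

text \<open>In the expansion of \<open>(g + h) ^ (k + l)\<close> every term contains
  \<open>g ^ k\<close> or \<open>h ^ l\<close>.\<close>

lemma denominators_add:
  assumes S: "is_subring S" and g: "g \<in> denominators S u" and h: "h \<in> denominators S u"
  shows "g + h \<in> denominators S u"
proof -
  note C = subring_closed[OF S]
  obtain k where k: "u * g ^ k \<in> S" using g by (auto simp: denominators_def)
  obtain l where l: "u * h ^ l \<in> S" using h by (auto simp: denominators_def)
  have gh: "g \<in> S" "h \<in> S" using g h by (auto simp: denominators_def)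
  have "u * (of_nat ((k + l) choose i) * g ^ i * h ^ (k + l - i)) \<in> S" if "i \<le> k + l" for i
  proof -
    have o: "of_nat j \<in> S" for j by (induction j) (auto intro: C)
    show ?thesis
    proof (cases "k \<le> i")
      case True
      then obtain d where d: "i = k + d" using le_Suc_ex by blast
      have "u * (of_nat ((k + l) choose i) * g ^ i * h ^ (k + l - i)) =
        (u * g ^ k) * (of_nat ((k + l) choose i) * g ^ d * h ^ (k + l - i))"
        by (simp add: d power_add algebra_simps)
      moreover have "of_nat ((k + l) choose i) * g ^ d * h ^ (k + l - i) \<in> S"
        by (intro C(4,7) o gh)
      ultimately show ?thesis using C(4)[OF k] by simp
    next
      case False
      then obtain d where d: "k + l - i = l + d" 
        using le_Suc_ex[of l "k + l - i"] by fastforce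
      have "u * (of_nat ((k + l) choose i) * g ^ i * h ^ (k + l - i)) =
        (u * h ^ l) * (of_nat ((k + l) choose i) * g ^ i * h ^ d)"
        by (simp add: d power_add algebra_simps)
      moreover have "of_nat ((k + l) choose i) * g ^ i * h ^ d \<in> S"
        by (intro C(4,7) o gh)
      ultimately show ?thesis using C(4)[OF l] by simp
    qed
  qed
  hence "u * (g + h) ^ (k + l) \<in> S"
    unfolding binomial_ring sum_distrib_left by (intro subring_sum[OF S]) auto
  thus ?thesis using gh C by (auto simp: denominators_def)
qed

lemma is_ideal_denominators:
  assumes S: "is_subring S"
  shows "is_ideal S (denominators S u)"
proof -
  have "0 \<in> denominators S u"
    using S by (auto simp: denominators_def subring_closed intro!: exI[of _ 1])
  thus ?thesis using denominators_add[OF S] denominators_mult[OF S]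
    unfolding is_ideal_def by (simp add: subset_iff) (simp add: denominators_def)
qed

lemma denominators_one: "1 \<in> denominators S u \<Longrightarrow> u \<in> S"
  by (auto simp: denominators_def)

text \<open>Elements that some power of \<open>g\<close> carries into \<open>S\<close> form a ring,
  so a generated ring can be placed among them by checking its generators.\<close>

lemma is_subring_localization:
  assumes S: "is_subring S" and g: "g \<in> S"
  shows "is_subring {u. \<exists>k. u * g ^ k \<in> S}"
proof -
  note C = subring_closed[OF S]
  have "(\<exists>k. (a + b) * g ^ k \<in> S) \<and> (\<exists>k. a * b * g ^ k \<in> S)"
    if "a * g ^ k \<in> S" "b * g ^ l \<in> S" for a b k l
  proof -
    have "(a + b) * g ^ (k + l) = (a * g ^ k) * g ^ l + (b * g ^ l) * g ^ k"
      "a * b * g ^ (k + l) = (a * g ^ k) * (b * g ^ l)"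
      by (simp_all add: algebra_simps power_add)
    thus ?thesis using that g C by metis
  qed
  moreover have "- a * g ^ k \<in> S" if "a * g ^ k \<in> S" for a k
    using C(5)[OF that] by simp
  moreover have "\<exists>k. (0::'a) * g ^ k \<in> S" "\<exists>k. 1 * g ^ k \<in> S"
    using g C by auto
  ultimately show ?thesis unfolding is_subring_def mem_Collect_eq by blast
qed

text \<open>For \<open>i\<close> in \<open>J\<close>, the inverse of \<open>y i\<close> times the
  product is the product of the remaining factors, which lies in \<open>L\<close>; the other
  generators lie in \<open>L\<close> already.\<close>

lemma prod_in_denominators:
  assumes L: "is_subring L" and J: "finite J" and y: "\<And>i. i \<in> J \<Longrightarrow> y i \<noteq> 0"
    "\<And>i. i \<in> I \<union> J \<Longrightarrow> y i \<in> L" "\<And>i. i \<in> I - J \<Longrightarrow> inverse (y i) \<in> L"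
    and u: "u \<in> laurent_on I y"
  shows "(\<Prod>i\<in>J. y i) \<in> denominators L u"
proof -
  let ?g = "\<Prod>i\<in>J. y i"
  have g: "?g \<in> L" using y(2) by (intro subring_prod L) auto
  have "laurent_on I y \<subseteq> {u. \<exists>k. u * ?g ^ k \<in> L}"
  proof (rule laurent_on_least[OF is_subring_localization[OF L g]])
    fix i assume i: "i \<in> I"
    show "y i \<in> {u. \<exists>k. u * ?g ^ k \<in> L}" using y(2) i by (auto intro!: exI[of _ 0])
    show "inverse (y i) \<in> {u. \<exists>k. u * ?g ^ k \<in> L}"
    proof (cases "i \<in> J")
      case True
      have "inverse (y i) * ?g ^ 1 = (\<Prod>i\<in>J - {i}. y i)"
        using y(1)[OF True] by (simp add: prod.remove[OF J True])
      moreover have "\<dots> \<in> L" using y(2) by (intro subring_prod L) auto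
      ultimately show ?thesis by (metis mem_Collect_eq)
    next
      case False
      thus ?thesis using y(3) i by (auto intro!: exI[of _ 0])
    qed
  qed
  thus ?thesis using u g by (auto simp: denominators_def)
qed

subsection \<open>Transcendental elements\<close>

definition transc_over :: "'a::field set \<Rightarrow> 'a \<Rightarrow> bool" where
  "transc_over K w \<longleftrightarrow> (\<forall>p\<in>polys_over K. poly p w = 0 \<longrightarrow> p = 0)"

lemma transc_overD: "transc_over K w \<Longrightarrow> p \<in> polys_over K \<Longrightarrow> poly p w = 0 \<Longrightarrow> p = 0"
  by (auto simp: transc_over_def)

lemma transc_over_unique:
  assumes "is_subring K" "transc_over K w" "p \<in> polys_over K" "q \<in> polys_over K" "poly p w = poly q w"
  shows "p = q"
  using transc_overD[OF assms(2), of "p - q"] assms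
  by (auto simp: subring_closed is_subring_polys_over)

lemma transc_over_mono: "transc_over L w \<Longrightarrow> K \<subseteq> L \<Longrightarrow> transc_over K w"
  by (auto simp: transc_over_def polys_over_def)

lemma transc_over_nonzero:
  assumes "is_subring K" "transc_over K w" shows "w \<noteq> 0"
proof
  assume "w = 0"
  hence "monom 1 1 = (0 :: 'a poly)"
    using assms by (intro transc_overD[OF assms(2)] polys_over_monom)
      (auto simp: poly_monom subring_closed)
  thus False by simp
qed

text \<open>Substituting \<open>Q * inverse w\<close> and multiplying by \<open>w ^ degree q\<close>
  reverses the coefficients and scales them by powers of \<open>Q\<close>, so they stay in
  \<open>K\<close>.\<close>

lemma poly_reverse_quotient:
  fixes w :: "'a::field"
  assumes K: "is_subring K" and Q: "Q \<in> K" and q: "q \<in> polys_over K" and w: "w \<noteq> 0"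
  obtains r where "r \<in> polys_over K" "poly r w = poly q (Q * inverse w) * w ^ degree q"
    "\<And>i. i \<le> degree q \<Longrightarrow> coeff r (degree q - i) = coeff q i * Q ^ i"
proof
  define d where "d = degree q"
  define r where "r = (\<Sum>i\<le>d. monom (coeff q i * Q ^ i) (d - i))"
  show "r \<in> polys_over K"
    unfolding r_def using q Q K
    by (intro subring_sum is_subring_polys_over polys_over_monom subring_closed(4,7)[OF K]) (auto simp: polys_overD)
  show "poly r w = poly q (Q * inverse w) * w ^ degree q"
    unfolding r_def poly_sum poly_altdef[of q] d_def[symmetric] sum_distrib_right
    by (intro sum.cong) (auto simp: poly_monom power_mult_distrib power_diff w divide_simps)
  show "coeff r (degree q - i) = coeff q i * Q ^ i" if "i \<le> degree q" for i
  proof -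
    have "coeff r (d - i) = (\<Sum>j\<le>d. if j = i then coeff q j * Q ^ j else 0)"
      unfolding r_def coeff_sum using that d_def by (intro sum.cong) auto
    thus ?thesis using that by (simp add: d_def)
  qed
qed

lemma transc_over_quotient:
  assumes K: "is_subring K" and w: "transc_over K w" and Q: "Q \<in> K" "Q \<noteq> 0"
  shows "transc_over K (Q * inverse w)"
  unfolding transc_over_def
proof (intro ballI impI)
  fix p assume p: "p \<in> polys_over K" "poly p (Q * inverse w) = 0"
  note w0 = transc_over_nonzero[OF K w]
  obtain q where q: "q \<in> polys_over K" "poly q w = poly p (Q * inverse w) * w ^ degree p"
    "\<And>i. i \<le> degree p \<Longrightarrow> coeff q (degree p - i) = coeff p i * Q ^ i"
    using poly_reverse_quotient[OF K Q(1) p(1) w0] by blast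
  have "q = 0" using q(1,2) p(2) by (intro transc_overD[OF w]) auto
  \<comment> \<open>At this index the constant coefficient of \<open>q\<close> is the leading
    coefficient of \<open>p\<close> times a nonzero power of \<open>Q\<close>.\<close>
  thus "p = 0" using q(3)[of "degree p"] Q(2) by (simp add: leading_coeff_0_iff)
qed

text \<open>With it, algebraic independence survives an exchange without expansions in monomials.\<close>

lemma transc_over_swap:
  assumes R: "is_subring R" and w: "transc_over R w" and z: "transc_over (laurent_adj R w) z"
  shows "transc_over (laurent_adj R z) w"
  unfolding transc_over_def
proof (intro ballI impI)
  fix p assume p: "p \<in> polys_over (laurent_adj R z)" "poly p w = 0"
  note A = is_subring_laurent_adj[OF R, of w]
  note z0 = transc_over_nonzero[OF A z]
  define d where "d = degree p"
  have "\<exists>N. \<exists>c\<in>polys_over R. coeff p i * z ^ N = poly c z" for i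
    using polys_overD[OF p(1), of i] by (auto simp: laurent_adj_def)
  then obtain N c where c: "\<And>i. c i \<in> polys_over R" "\<And>i. coeff p i * z ^ N i = poly (c i) z"
    by metis
  define M where "M = (\<Sum>i\<le>d. N i)"
  define c' where "c' i = c i * monom 1 (M - N i)" for i
  have c': "c' i \<in> polys_over R" for i
    unfolding c'_def using R c(1)
    by (intro subring_closed is_subring_polys_over polys_over_monom) auto
  have ev: "poly (c' i) z = coeff p i * z ^ M" if "i \<le> d" for i
  proof -
    have "N i \<le> M" unfolding M_def using that by (intro member_le_sum) auto
    thus ?thesis unfolding c'_def by (simp add: poly_monom c(2)[symmetric] mult.assoc flip: power_add)
  qed
  define e where "e = Max ((\<lambda>i. degree (c' i)) ` {..d})"
  have deg: "degree (c' i) \<le> e" if "i \<le> d" for i unfolding e_def using that by auto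
  \<comment> \<open>The relation, cleared of powers of \<open>z\<close>, is a double sum in powers
    of \<open>w\<close> and \<open>z\<close>. \<open>r l\<close> collects the terms with
    \<open>z ^ l\<close> as a polynomial in \<open>w\<close>, so \<open>q\<close> is the same
    relation read as a polynomial in \<open>z\<close>.\<close>
  define r where "r l = (\<Sum>i\<le>d. monom (coeff (c' i) l) i)" for l
  define q where "q = (\<Sum>l\<le>e. monom (poly (r l) w) l)"
  have r: "r l \<in> polys_over R" for l
    unfolding r_def using R c' by (intro subring_sum is_subring_polys_over polys_over_monom) (auto simp: polys_overD)
  have "q \<in> polys_over (laurent_adj R w)"
    unfolding q_def using A r
    by (intro subring_sum is_subring_polys_over polys_over_monom poly_in_laurent_adj)
  moreover have "poly q z = 0"
  proof -
    have "poly q z = (\<Sum>l\<le>e. \<Sum>i\<le>d. coeff (c' i) l * w ^ i * z ^ l)"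
      by (simp add: q_def r_def poly_sum poly_monom sum_distrib_right)
    also have "\<dots> = (\<Sum>i\<le>d. \<Sum>l\<le>e. coeff (c' i) l * w ^ i * z ^ l)" by (rule sum.swap)
    also have "\<dots> = (\<Sum>i\<le>d. poly (c' i) z * w ^ i)"
    proof (intro sum.cong refl)
      fix i assume "i \<in> {..d}"
      hence "poly (c' i) z = (\<Sum>l\<le>e. coeff (c' i) l * z ^ l)"
        unfolding poly_altdef using deg[of i]
        by (intro sum.mono_neutral_left) (auto simp: coeff_eq_0)
      thus "(\<Sum>l\<le>e. coeff (c' i) l * w ^ i * z ^ l) = poly (c' i) z * w ^ i"
        by (simp add: sum_distrib_left sum_distrib_right algebra_simps)
    qed
    also have "\<dots> = (\<Sum>i\<le>d. coeff p i * w ^ i) * z ^ M"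
      by (simp add: ev sum_distrib_right sum_distrib_left algebra_simps)
    also have "(\<Sum>i\<le>d. coeff p i * w ^ i) = poly p w" by (simp add: poly_altdef d_def)
    finally show ?thesis using p(2) by simp
  qed
  ultimately have q0: "q = 0" by (rule transc_overD[OF z])
  have "r l = 0" if "l \<le> e" for l
  proof (rule transc_overD[OF w r])
    have "0 = coeff q l" by (simp add: q0)
    also have "\<dots> = (\<Sum>j\<le>e. if j = l then poly (r j) w else 0)"
      unfolding q_def coeff_sum by (intro sum.cong) auto
    finally show "poly (r l) w = 0" using that by simp
  qed
  hence "coeff (c' i) l = 0" if "i \<le> d" "l \<le> e" for i l
  proof -
    have "0 = coeff (r l) i" using \<open>\<And>l. l \<le> e \<Longrightarrow> r l = 0\<close> that by simp
    also have "\<dots> = (\<Sum>j\<le>d. if j = i then coeff (c' j) l else 0)"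
      unfolding r_def coeff_sum by (intro sum.cong) auto
    finally show ?thesis using that by simp
  qed
  hence "c' i = 0" if "i \<le> d" for i using that deg[OF that] by (metis leading_coeff_0_iff)
  hence "coeff p i = 0" if "i \<le> d" for i using ev[OF that] that z0 by simp
  thus "p = 0" by (metis d_def leading_coeff_0_iff order_refl)
qed

subsection \<open>Independent variables and Laurent monomials\<close>

text \<open>Independence is stated one variable at a time, the form needed for comparing
  coefficients in a chosen variable.\<close>

definition independent_on :: "nat set \<Rightarrow> (nat \<Rightarrow> 'a::field) \<Rightarrow> bool" where
  "independent_on I x \<longleftrightarrow> (\<forall>k\<in>I. transc_over (laurent_on (I - {k}) x) (x k))"

lemma independent_onD: "independent_on I x \<Longrightarrow> k \<in> I \<Longrightarrow> transc_over (laurent_on (I - {k}) x) (x k)"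
  by (simp add: independent_on_def)

lemma independent_on_nonzero: "independent_on I x \<Longrightarrow> i \<in> I \<Longrightarrow> x i \<noteq> 0"
  using transc_over_nonzero[OF is_subring_laurent_on] independent_onD by blast

lemma independent_on_reindex:
  assumes "independent_on I x" "\<sigma> permutes I"
  shows "independent_on I (\<lambda>i. x (\<sigma> i))"
  unfolding independent_on_def
proof
  fix k assume k: "k \<in> I"
  have "\<sigma> ` (I - {k}) = I - {\<sigma> k}"
    using permutes_image[OF assms(2)] inj_image_mem_iff[OF permutes_inj[OF assms(2)]]
    by (auto simp: image_set_diff[OF permutes_inj[OF assms(2)]])
  moreover have "\<sigma> k \<in> I" using permutes_in_image[OF assms(2)] k by simp
  ultimately show "transc_over (laurent_on (I - {k}) (\<lambda>i. x (\<sigma> i))) (x (\<sigma> k))"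
    using independent_onD[OF assms(1)] by (simp add: laurent_on_reindex)
qed

text \<open>The new variable is handled by \<open>transc_over_quotient\<close>. For another index
  \<open>j\<close>, \<open>transc_over_swap\<close> interchanges \<open>x j\<close> and the new
  variable over the Laurent ring that omits both.\<close>

lemma independent_on_exchange:
  assumes x: "independent_on I x" and k: "k \<in> I" and Q: "Q \<in> laurent_on (I - {k}) x" "Q \<noteq> 0"
  shows "independent_on I (x(k := Q * inverse (x k)))"
proof -
  define y where "y = x(k := Q * inverse (x k))"
  have yk: "transc_over (laurent_on (I - {k}) x) (y k)"
    using transc_over_quotient[OF is_subring_laurent_on independent_onD[OF x k] Q]
    by (simp add: y_def)
  have y0: "y k \<noteq> 0" using transc_over_nonzero[OF is_subring_laurent_on yk] .
  have "transc_over (laurent_on (I - {j}) y) (y j)" if j: "j \<in> I" for j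
  proof (cases "j = k")
    case True
    have "laurent_on (I - {k}) y = laurent_on (I - {k}) x" 
      by (intro laurent_on_cong) (auto simp: y_def)
    thus ?thesis using yk True by simp
  next
    case False
    define R where "R = laurent_on (I - {j} - {k}) x"
    have R: "is_subring R" by (simp add: R_def is_subring_laurent_on)
    have 1: "transc_over R (x j)"
      using independent_onD[OF x j] by (rule transc_over_mono) (auto simp: R_def intro!: laurent_on_mono)
    have "laurent_on (I - {k}) x = laurent_adj R (x j)"
    proof -
      have "insert j (I - {j} - {k}) = I - {k}" using j False by auto
      thus ?thesis
        using laurent_on_insert[of x j "I - {j} - {k}"] independent_on_nonzero[OF x j]
        by (simp add: R_def)
    qed
    hence "transc_over (laurent_adj R (x j)) (y k)" using yk by simp
    from transc_over_swap[OF R 1 this] have "transc_over (laurent_adj R (y k)) (x j)" .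
    moreover have "R = laurent_on (I - {j} - {k}) y"
      unfolding R_def by (intro laurent_on_cong) (auto simp: y_def)
    moreover have "laurent_on (I - {j}) y = laurent_adj (laurent_on (I - {j} - {k}) y) (y k)"
      using y0 k False by (intro laurent_on_remove) auto
    ultimately show ?thesis using False by (simp add: y_def)
  qed
  thus ?thesis by (simp add: independent_on_def y_def)
qed

definition laurent_monomial :: "nat set \<Rightarrow> (nat \<Rightarrow> 'a::field) \<Rightarrow> (nat \<Rightarrow> int) \<Rightarrow> 'a" where
  "laurent_monomial I x e = (\<Prod>i\<in>I. x i powi e i)"

lemma subring_powi:
  "is_subring S \<Longrightarrow> a \<in> S \<Longrightarrow> inverse a \<in> S \<Longrightarrow> a powi b \<in> S"
  by (simp add: power_int_def subring_closed)

lemma laurent_monomial_in: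
  assumes "\<And>i. i \<in> I \<Longrightarrow> i \<notin> J \<Longrightarrow> e i = 0"
  shows "laurent_monomial I x e \<in> laurent_on J x"
  unfolding laurent_monomial_def
proof (intro subring_prod is_subring_laurent_on)
  fix i assume "i \<in> I"
  thus "x i powi e i \<in> laurent_on J x"
    using assms[of i] laurent_on_gen[of i J x] laurent_on_closed(2)[of J x]
    by (cases "i \<in> J") (auto intro: subring_powi[OF is_subring_laurent_on])
qed

lemma laurent_monomial_cong:
  "(\<And>i. i \<in> I \<Longrightarrow> e i = f i) \<Longrightarrow> (\<And>i. i \<in> I \<Longrightarrow> e i \<noteq> 0 \<Longrightarrow> x i = y i) \<Longrightarrow>
    laurent_monomial I x e = laurent_monomial I y f"
  unfolding laurent_monomial_def by (intro prod.cong refl) (metis (full_types) power_int_0_right)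

lemma laurent_monomial_minus: "inverse (laurent_monomial I x e) = laurent_monomial I x (\<lambda>i. - e i)"
  by (simp add: laurent_monomial_def power_int_minus flip: prod_inversef)

lemma laurent_monomial_add:
  "(\<And>i. i \<in> I \<Longrightarrow> x i \<noteq> 0) \<Longrightarrow>
    laurent_monomial I x (\<lambda>i. e i + f i) = laurent_monomial I x e * laurent_monomial I x f"
  by (simp add: laurent_monomial_def power_int_add flip: prod.distrib)

lemma laurent_monomial_nonzero:
  "finite I \<Longrightarrow> (\<And>i. i \<in> I \<Longrightarrow> x i \<noteq> 0) \<Longrightarrow> laurent_monomial I x e \<noteq> 0"
  by (simp add: laurent_monomial_def power_int_not_zero)

lemma laurent_monomial_powi:
  "laurent_monomial I x e powi a = laurent_monomial I x (\<lambda>i. e i * a)"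
  unfolding laurent_monomial_def
  by (induction I rule: infinite_finite_induct) (simp_all add: power_int_mult_distrib power_int_mult)

lemma laurent_monomial_zero: "(\<And>i. i \<in> I \<Longrightarrow> e i = 0) \<Longrightarrow> laurent_monomial I x e = 1"
  by (simp add: laurent_monomial_def)

lemma laurent_monomial_remove:
  "finite I \<Longrightarrow> q \<in> I \<Longrightarrow>
    laurent_monomial I x e = laurent_monomial I x (e(q := 0)) * x q powi e q"
  unfolding laurent_monomial_def by (subst (1 2) prod.remove[of I q]) (auto intro!: prod.cong)

text \<open>Coefficients in \<open>x q\<close> are compared: the monomial would be a constant, yet
  it is a nonzero constant times a nonzero power of \<open>x q\<close>. A negative power is moved to
  the other side first.\<close>

lemma laurent_monomial_notin:
  assumes x: "independent_on I x" and I: "finite I" and q: "q \<in> I" "e q \<noteq> 0"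
  shows "laurent_monomial I x e \<notin> laurent_on (I - {q}) x"
proof
  assume c: "laurent_monomial I x e \<in> laurent_on (I - {q}) x" (is "?c \<in> ?K")
  note K = is_subring_laurent_on[of "I - {q}" x]
  note t = independent_onD[OF x q(1)]
  define \<mu> where "\<mu> = laurent_monomial I x (e(q := 0))"
  have \<mu>: "\<mu> \<in> ?K" "\<mu> \<noteq> 0"
    unfolding \<mu>_def
    by (rule laurent_monomial_in, simp)
      (rule laurent_monomial_nonzero[OF I independent_on_nonzero[OF x]])
  have eq: "?c = \<mu> * x q powi e q"
    unfolding \<mu>_def using I q(1) by (rule laurent_monomial_remove)
  define b where "b = nat \<bar>e q\<bar>"
  have b: "b > 0" using q(2) by (simp add: b_def)
  show False
  proof (cases "e q > 0")
    case True
    hence "poly (monom \<mu> b) (x q) = poly (monom ?c 0) (x q)"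
      by (simp add: poly_monom eq b_def power_int_def)
    hence "monom \<mu> b = monom ?c 0"
      by (intro transc_over_unique[OF K t] polys_over_monom K \<mu> c)
    hence "coeff (monom \<mu> b) b = coeff (monom ?c 0) b" by simp
    thus False using b \<mu> by simp
  next
    case False
    hence "poly (monom ?c b) (x q) = poly (monom \<mu> 0) (x q)"
      using independent_on_nonzero[OF x q(1)]
      by (simp add: poly_monom eq b_def power_int_def field_simps)
    hence "monom ?c b = monom \<mu> 0"
      by (intro transc_over_unique[OF K t] polys_over_monom K \<mu> c)
    hence "coeff (monom ?c b) 0 = coeff (monom \<mu> 0) 0" by simp
    thus False using b \<mu> by simp
  qed
qed

section \<open>Exchange binomials\<close>

definition exchange_binomial :: "nat \<Rightarrow> (nat \<Rightarrow> 'a::field) \<Rightarrow> (nat \<Rightarrow> nat \<Rightarrow> int) \<Rightarrow> nat \<Rightarrow> 'a" where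
  "exchange_binomial n x B k = laurent_monomial {1..n} x (\<lambda>i. max 0 (B i k)) +
     laurent_monomial {1..n} x (\<lambda>i. max 0 (- B i k))"

lemma exchanged_var_eq: "exchanged_var n x B k = exchange_binomial n x B k * inverse (x k)"
proof -
  have "(\<Prod>j | j \<in> {1..n} \<and> B j k > 0. x j ^ nat (B j k)) =
      laurent_monomial {1..n} x (\<lambda>i. max 0 (B i k))" if "True" for B :: "nat \<Rightarrow> nat \<Rightarrow> int"
    unfolding laurent_monomial_def by (intro prod.mono_neutral_cong_left) (auto simp: power_int_def le_less)
  from this[of B] this[of "\<lambda>i j. - B i j"] show ?thesis
    by (simp add: exchanged_var_def exchange_binomial_def)
qed

lemma exchange_binomial_uminus: "exchange_binomial n x (\<lambda>i j. - B i j) k = exchange_binomial n x B k"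
  by (simp add: exchange_binomial_def add.commute)

text \<open>Pointwise, \<open>max 0 b = max 0 (- b) + b\<close>. Where the first factor is a unit,
  the binomial can thus be traded for one plus the monomial of column \<open>k\<close>.\<close>

lemma exchange_binomial_factor:
  assumes "\<And>i. i \<in> {1..n} \<Longrightarrow> x i \<noteq> 0"
  shows "exchange_binomial n x B k = laurent_monomial {1..n} x (\<lambda>i. max 0 (- B i k)) *
    (1 + laurent_monomial {1..n} x (\<lambda>i. B i k))"
proof -
  have "laurent_monomial {1..n} x (\<lambda>i. max 0 (B i k)) =
    laurent_monomial {1..n} x (\<lambda>i. max 0 (- B i k) + B i k)"
    by (intro laurent_monomial_cong) auto
  also have "\<dots> = laurent_monomial {1..n} x (\<lambda>i. max 0 (- B i k)) * laurent_monomial {1..n} x (\<lambda>i. B i k)"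
    using assms by (rule laurent_monomial_add)
  finally show ?thesis by (simp add: exchange_binomial_def algebra_simps)
qed

lemma exchange_binomial_in:
  assumes "\<And>i. i \<in> {1..n} \<Longrightarrow> i \<notin> J \<Longrightarrow> B i k = 0"
  shows "exchange_binomial n x B k \<in> laurent_on J x"
  unfolding exchange_binomial_def using assms
  by (intro laurent_on_closed laurent_monomial_in) auto

text \<open>A zero column gives 1 + 1, nonzero in characteristic zero. Otherwise the monomial
  involves some variable and cannot equal -1, which lies in the Laurent ring of the other
  variables.\<close>

lemma exchange_binomial_nonzero:
  fixes x :: "nat \<Rightarrow> 'a::field_char_0"
  assumes x: "independent_on {1..n} x"
  shows "exchange_binomial n x B k \<noteq> 0"
proof -
  note x0 = independent_on_nonzero[OF x]
  have "1 + laurent_monomial {1..n} x (\<lambda>i. B i k) \<noteq> 0"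
  proof (cases "\<forall>i\<in>{1..n}. B i k = 0")
    case True
    thus ?thesis by (subst laurent_monomial_zero) auto
  next
    case False
    then obtain q where q: "q \<in> {1..n}" "B q k \<noteq> 0" by blast
    have "-1 \<in> laurent_on ({1..n} - {q}) x" by (intro laurent_on_closed)
    hence "laurent_monomial {1..n} x (\<lambda>i. B i k) \<noteq> -1"
      using laurent_monomial_notin[OF x _ q(1), of "\<lambda>i. B i k"] q(2) by auto
    thus ?thesis by (metis add.commute add_eq_0_iff)
  qed
  thus ?thesis
    using laurent_monomial_nonzero[of "{1..n}" x "\<lambda>i. max 0 (- B i k)"]
      exchange_binomial_factor[of n x B k] x0 by auto
qed

text \<open>Only variables with nonzero exponent are compared. When the diagonal entry is zero,
  replacing \<open>x k\<close> therefore leaves the binomial of column \<open>k\<close>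
  unchanged.\<close>

lemma exchange_binomial_cong:
  "(\<And>i. i \<in> {1..n} \<Longrightarrow> B i k = C i k) \<Longrightarrow> (\<And>i. i \<in> {1..n} \<Longrightarrow> B i k \<noteq> 0 \<Longrightarrow> x i = y i) \<Longrightarrow>
    exchange_binomial n x B k = exchange_binomial n y C k"
  unfolding exchange_binomial_def
  by (intro arg_cong2[where f = "(+)"] laurent_monomial_cong) (auto simp: max_def split: if_splits)

subsection \<open>Seeds\<close>

lemma mutate_matrix_summand_even: "even (\<bar>a\<bar> * b + a * \<bar>b\<bar>)" for a b :: int
  by (cases "a \<ge> 0"; cases "b \<ge> 0") auto

text \<open>Doubling removes the integer division, so that identities for mutated matrices can be
  checked by ring arithmetic.\<close>

lemma mutate_matrix_double:
  "i \<noteq> k \<Longrightarrow> j \<noteq> k \<Longrightarrow>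
    2 * mutate_matrix k B i j = 2 * B i j + (\<bar>B i k\<bar> * B k j + B i k * \<bar>B k j\<bar>)"
  using mutate_matrix_summand_even[of "B i k" "B k j"] unfolding mutate_matrix_def
  by (simp only: if_False simp_thms distrib_left dvd_mult_div_cancel)

lemma mutate_matrix_uminus: "mutate_matrix k (\<lambda>i j. - B i j) i j = - mutate_matrix k B i j"
proof (cases "i = k \<or> j = k")
  case False
  thus ?thesis
    using mutate_matrix_double[of i k j B] mutate_matrix_double[of i k j "\<lambda>i j. - B i j"] by simp
qed (auto simp: mutate_matrix_def)

lemma mutate_matrix_involutive: "mutate_matrix k (mutate_matrix k B) = B"
proof (intro ext)
  fix i j
  show "mutate_matrix k (mutate_matrix k B) i j = B i j"
  proof (cases "i = k \<or> j = k")
    case False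
    have "mutate_matrix k B i k = - B i k" "mutate_matrix k B k j = - B k j"
      by (simp_all add: mutate_matrix_def)
    with False have "2 * mutate_matrix k (mutate_matrix k B) i j = 2 * mutate_matrix k B i j -
        (\<bar>B i k\<bar> * B k j + B i k * \<bar>B k j\<bar>)"
      using mutate_matrix_double[of i k j "mutate_matrix k B"] by simp
    thus ?thesis using mutate_matrix_double[of i k j B] False by simp
  qed (auto simp: mutate_matrix_def)
qed

lemma skew_symmetrizable_sign:
  assumes B: "skew_symmetrizable m B" and ij: "i \<in> {1..m}" "j \<in> {1..m}"
  shows "B i i = 0" "B i j < 0 \<longleftrightarrow> B j i > 0" "B i j = 0 \<longleftrightarrow> B j i = 0"
proof -
  obtain d :: "nat \<Rightarrow> int" where d: "\<And>i. i \<in> {1..m} \<Longrightarrow> d i > 0"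
    "\<And>i j. i \<in> {1..m} \<Longrightarrow> j \<in> {1..m} \<Longrightarrow> d i * B i j = - (d j * B j i)"
    using B unfolding skew_symmetrizable_def by blast
  have eq: "d i * B i j = - (d j * B j i)" and p: "d i > 0" "d j > 0" using d ij by blast+
  show "B i i = 0" using d(1)[OF ij(1)] d(2)[OF ij(1) ij(1)] by simp
  show "B i j < 0 \<longleftrightarrow> B j i > 0"
  proof -
    have "B i j < 0 \<longleftrightarrow> d i * B i j < 0" using p by (simp add: mult_less_0_iff)
    also have "\<dots> \<longleftrightarrow> d j * B j i > 0" by (simp add: eq)
    also have "\<dots> \<longleftrightarrow> B j i > 0" using p by (simp add: zero_less_mult_iff)
    finally show ?thesis .
  qed
  show "B i j = 0 \<longleftrightarrow> B j i = 0" using eq p by auto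
qed

text \<open>The same symmetrizing integers \<open>d\<close> serve after mutation: the correction
  term is carried from \<open>d i\<close> through \<open>d k\<close> to \<open>d j\<close>.\<close>

lemma skew_symmetrizable_mutate:
  assumes "skew_symmetrizable m B" and k: "k \<in> {1..m}"
  shows "skew_symmetrizable m (mutate_matrix k B)"
proof -
  obtain d :: "nat \<Rightarrow> int" where d: "\<And>i. i \<in> {1..m} \<Longrightarrow> d i > 0"
    and e: "\<And>i j. i \<in> {1..m} \<Longrightarrow> j \<in> {1..m} \<Longrightarrow> d i * B i j = - (d j * B j i)"
    using assms(1) unfolding skew_symmetrizable_def by blast
  have a: "d i * \<bar>B i j\<bar> = d j * \<bar>B j i\<bar>" if "i \<in> {1..m}" "j \<in> {1..m}" for i j
    using arg_cong[OF e[OF that], of abs] d[of i] d[of j] that by (simp add: abs_mult)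
  have "d i * mutate_matrix k B i j = - (d j * mutate_matrix k B j i)"
    if ij: "i \<in> {1..m}" "j \<in> {1..m}" for i j
  proof (cases "i = k \<or> j = k")
    case True
    thus ?thesis using e[OF ij] by (auto simp: mutate_matrix_def)
  next
    case False
    have "d i * (\<bar>B i k\<bar> * B k j + B i k * \<bar>B k j\<bar>) =
        (d i * \<bar>B i k\<bar>) * B k j + (d i * B i k) * \<bar>B k j\<bar>"
      by (simp add: algebra_simps)
    also have "\<dots> = \<bar>B k i\<bar> * (d k * B k j) - B k i * (d k * \<bar>B k j\<bar>)"
      unfolding a[OF ij(1) k] e[OF ij(1) k] by (simp add: algebra_simps)
    also have "\<dots> = - (d j * (\<bar>B j k\<bar> * B k i + B j k * \<bar>B k i\<bar>))"
      unfolding a[OF k ij(2)] e[OF k ij(2)] by (simp add: algebra_simps)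
    finally have "d i * (2 * mutate_matrix k B i j) = - (d j * (2 * mutate_matrix k B j i))"
      using False e[OF ij] by (simp add: mutate_matrix_double distrib_left)
    thus ?thesis by linarith
  qed
  thus ?thesis using d unfolding skew_symmetrizable_def by blast
qed

lemma skew_symmetrizable_permute:
  assumes "skew_symmetrizable m B" "\<sigma> ` {1..m} = {1..m}"
  shows "skew_symmetrizable m (\<lambda>i j. B (\<sigma> i) (\<sigma> j))"
proof -
  obtain d :: "nat \<Rightarrow> int" where d: "\<forall>i\<in>{1..m}. d i > 0"
    "\<forall>i\<in>{1..m}. \<forall>j\<in>{1..m}. d i * B i j = - (d j * B j i)"
    using assms(1) unfolding skew_symmetrizable_def by blast
  have "\<sigma> i \<in> {1..m}" if "i \<in> {1..m}" for i using that assms(2) by blast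
  thus ?thesis unfolding skew_symmetrizable_def using d
    by (intro exI[of _ "\<lambda>i. d (\<sigma> i)"] conjI ballI) blast+
qed

text \<open>Independence enters in the form that \<open>independent_on_exchange\<close> preserves,
  which makes this an invariant of mutation.\<close>

definition good_seed :: "nat \<Rightarrow> nat \<Rightarrow> 'a::field seed \<Rightarrow> bool" where
  "good_seed n m = (\<lambda>(x, B). skew_symmetrizable m B \<and> independent_on {1..n} x)"

lemma mutate_eq:
  "mutate n k (x, B) = (x(k := exchange_binomial n x B k * inverse (x k)), mutate_matrix k B)"
  by (simp add: mutate_def exchanged_var_eq)

lemma good_seed_mutate:
  fixes s :: "'a::field_char_0 seed"
  assumes "good_seed n m s" "k \<in> {1..m}" "m \<le> n"
  shows "good_seed n m (mutate n k s)"
proof -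
  obtain x B where s: "s = (x, B)" by force
  have x: "independent_on {1..n} x" and B: "skew_symmetrizable m B"
    using assms(1) by (auto simp: s good_seed_def)
  have "exchange_binomial n x B k \<in> laurent_on ({1..n} - {k}) x"
    using skew_symmetrizable_sign(1)[OF B assms(2,2)] by (intro exchange_binomial_in) auto
  hence "independent_on {1..n} (x(k := exchange_binomial n x B k * inverse (x k)))"
    using assms(2,3) by (intro independent_on_exchange x exchange_binomial_nonzero) auto
  thus ?thesis using skew_symmetrizable_mutate[OF B assms(2)]
    by (simp add: s mutate_eq good_seed_def)
qed

text \<open>Column \<open>k\<close> only changes sign and its diagonal entry is zero, so both
  mutations use the same binomial \<open>P\<close>, and dividing \<open>P\<close> by
  \<open>P * inverse (x k)\<close> returns \<open>x k\<close>.\<close>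

lemma mutate_involutive:
  fixes s :: "'a::field_char_0 seed"
  assumes "good_seed n m s" "k \<in> {1..m}" "m \<le> n"
  shows "mutate n k (mutate n k s) = s"
proof -
  obtain x B where s: "s = (x, B)" by force
  have x: "independent_on {1..n} x" and B: "skew_symmetrizable m B"
    using assms(1) by (auto simp: s good_seed_def)
  define P where "P = exchange_binomial n x B k"
  have P: "P \<noteq> 0" unfolding P_def by (rule exchange_binomial_nonzero[OF x])
  define y where "y = x(k := P * inverse (x k))"
  have "exchange_binomial n y (mutate_matrix k B) k = exchange_binomial n y (\<lambda>i j. - B i j) k"
    by (intro exchange_binomial_cong) (auto simp: mutate_matrix_def)
  also have "\<dots> = P"
    unfolding exchange_binomial_uminus P_def
    using skew_symmetrizable_sign(1)[OF B assms(2,2)]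
    by (intro exchange_binomial_cong) (auto simp: y_def)
  finally have "exchange_binomial n y (mutate_matrix k B) k * inverse (y k) = x k"
    using P by (simp add: y_def)
  thus ?thesis unfolding s mutate_eq P_def[symmetric] y_def[symmetric] mutate_matrix_involutive
    by (simp add: y_def fun_eq_iff)
qed

lemma good_seed_permute:
  assumes "good_seed n m s" "\<sigma> permutes {1..n}" "\<sigma> ` {1..m} = {1..m}"
  shows "good_seed n m (permute_seed \<sigma> s)"
proof -
  obtain x B where s: "s = (x, B)" by force
  have "independent_on {1..n} x" "skew_symmetrizable m B"
    using assms(1) by (auto simp: s good_seed_def)
  thus ?thesis unfolding s good_seed_def permute_seed_def prod.case
    using independent_on_reindex[OF _ assms(2)] skew_symmetrizable_permute[OF _ assms(3)] by blast
qed

lemma exchanged_var_permute: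
  assumes \<sigma>: "\<sigma> permutes {1..n}"
  shows "exchanged_var n (\<lambda>i. x (\<sigma> i)) (\<lambda>i j. B (\<sigma> i) (\<sigma> j)) k = exchanged_var n x B (\<sigma> k)"
proof -
  have "laurent_monomial {1..n} (\<lambda>i. x (\<sigma> i)) (\<lambda>i. e (\<sigma> i)) = laurent_monomial {1..n} x e" for e
    unfolding laurent_monomial_def using prod.permute[OF \<sigma>, of "\<lambda>i. x i powi e i"]
    by (simp add: o_def)
  from this[of "\<lambda>i. max 0 (B i (\<sigma> k))"] this[of "\<lambda>i. max 0 (- B i (\<sigma> k))"]
  show ?thesis by (simp add: exchanged_var_eq exchange_binomial_def)
qed

subsection \<open>Algebraic independence\<close>

definition monomial_eval :: "(nat \<Rightarrow> 'a::comm_ring_1) \<Rightarrow> (nat \<Rightarrow>\<^sub>0 nat) \<Rightarrow> 'a" where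
  "monomial_eval x e = (\<Prod>i\<in>Poly_Mapping.keys e. x i ^ Poly_Mapping.lookup e i)"

lemma monomial_eval_superset:
  "finite A \<Longrightarrow> Poly_Mapping.keys e \<subseteq> A \<Longrightarrow>
    monomial_eval x e = (\<Prod>i\<in>A. x i ^ Poly_Mapping.lookup e i)"
  unfolding monomial_eval_def by (intro prod.mono_neutral_left) (auto simp: in_keys_iff)

lemma monomial_eval_add: "monomial_eval x (e + f) = monomial_eval x e * monomial_eval x f"
proof -
  let ?A = "Poly_Mapping.keys e \<union> Poly_Mapping.keys f"
  have "Poly_Mapping.keys (e + f) \<subseteq> ?A" by (rule Poly_Mapping.keys_add)
  thus ?thesis
    by (simp add: monomial_eval_superset[of ?A] lookup_add power_add prod.distrib)
qed

lemma poly_eval_eq: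
  "poly_eval x p = (\<Sum>e\<in>Poly_Mapping.keys p. of_rat (Poly_Mapping.lookup p e) * monomial_eval x e)"
  by (simp add: poly_eval_def monomial_eval_def)

lemma poly_eval_superset:
  "finite A \<Longrightarrow> Poly_Mapping.keys p \<subseteq> A \<Longrightarrow>
    poly_eval x p = (\<Sum>e\<in>A. of_rat (Poly_Mapping.lookup p e) * monomial_eval x e)"
  unfolding poly_eval_eq by (intro sum.mono_neutral_left) (auto simp: in_keys_iff)

lemma poly_eval_add: "poly_eval x (p + q) = poly_eval x p + poly_eval x q"
proof -
  let ?A = "Poly_Mapping.keys p \<union> Poly_Mapping.keys q"
  have "Poly_Mapping.keys (p + q) \<subseteq> ?A" by (rule Poly_Mapping.keys_add)
  thus ?thesis
    by (simp add: poly_eval_superset[of ?A] lookup_add of_rat_add distrib_right sum.distrib)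
qed

lemma poly_eval_zero: "poly_eval x 0 = 0"
  by (simp add: poly_eval_def)

lemma poly_eval_uminus: "poly_eval x (- p) = - poly_eval x p"
  using poly_eval_add[of x p "- p"] by (simp add: poly_eval_zero minus_unique)

lemma poly_eval_sum: "poly_eval x (sum f A) = (\<Sum>a\<in>A. poly_eval x (f a))"
  by (induction A rule: infinite_finite_induct) (simp_all add: poly_eval_add poly_eval_zero)

lemma poly_eval_single: "poly_eval x (Poly_Mapping.single e c) = of_rat c * monomial_eval x e"
  using poly_eval_superset[of "{e}" "Poly_Mapping.single e c" x] by simp

lemma poly_mapping_sum_singles:
  "p = (\<Sum>e\<in>Poly_Mapping.keys p. Poly_Mapping.single e (Poly_Mapping.lookup p e))"
proof (rule poly_mapping_eqI)
  fix a
  have "Poly_Mapping.lookup (\<Sum>e\<in>Poly_Mapping.keys p. Poly_Mapping.single e (Poly_Mapping.lookup p e)) a =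
    (\<Sum>e\<in>Poly_Mapping.keys p. if e = a then Poly_Mapping.lookup p e else 0)"
    by (simp add: lookup_sum lookup_single when_def)
  also have "\<dots> = Poly_Mapping.lookup p a" by (simp add: in_keys_iff)
  finally show "Poly_Mapping.lookup p a = Poly_Mapping.lookup
      (\<Sum>e\<in>Poly_Mapping.keys p. Poly_Mapping.single e (Poly_Mapping.lookup p e)) a" ..
qed

lemma poly_eval_mult: "poly_eval x (p * q) = poly_eval x p * poly_eval x q"
proof -
  have "p * q = (\<Sum>e\<in>Poly_Mapping.keys p. \<Sum>f\<in>Poly_Mapping.keys q.
      Poly_Mapping.single (e + f) (Poly_Mapping.lookup p e * Poly_Mapping.lookup q f))"
    by (subst poly_mapping_sum_singles[of p], subst poly_mapping_sum_singles[of q])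
       (simp add: sum_product mult_single)
  thus ?thesis
    by (simp add: poly_eval_sum poly_eval_single monomial_eval_add of_rat_mult
        poly_eval_eq[of x p] poly_eval_eq[of x q] sum_product algebra_simps)
qed

lemma lookup_mult_single_shift:
  fixes p :: "'b::cancel_comm_monoid_add \<Rightarrow>\<^sub>0 'c::comm_semiring_1"
  shows "Poly_Mapping.lookup (p * Poly_Mapping.single a 1) (e + a) = Poly_Mapping.lookup p e"
proof -
  have "p * Poly_Mapping.single a 1 =
    (\<Sum>f\<in>Poly_Mapping.keys p. Poly_Mapping.single (f + a) (Poly_Mapping.lookup p f))"
    by (subst poly_mapping_sum_singles[of p]) (simp add: sum_distrib_right mult_single)
  hence "Poly_Mapping.lookup (p * Poly_Mapping.single a 1) (e + a) =
    (\<Sum>f\<in>Poly_Mapping.keys p. if f = e then Poly_Mapping.lookup p f else 0)"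
    by (simp add: lookup_sum lookup_single when_def)
  thus ?thesis by (simp add: in_keys_iff)
qed

definition polys_in :: "nat set \<Rightarrow> ((nat \<Rightarrow>\<^sub>0 nat) \<Rightarrow>\<^sub>0 rat) set" where
  "polys_in J = {p. \<forall>e\<in>Poly_Mapping.keys p. Poly_Mapping.keys e \<subseteq> J}"

lemma is_subring_polys_in: "is_subring (polys_in J)"
proof -
  have "p + q \<in> polys_in J" if "p \<in> polys_in J" "q \<in> polys_in J" for p q
    using that Poly_Mapping.keys_add[of p q] unfolding polys_in_def by blast
  moreover have "p * q \<in> polys_in J" if pq: "p \<in> polys_in J" "q \<in> polys_in J" for p q
    unfolding polys_in_def
  proof (intro CollectI ballI)
    fix e assume "e \<in> Poly_Mapping.keys (p * q)"
    then obtain a b where "e = a + b" "a \<in> Poly_Mapping.keys p" "b \<in> Poly_Mapping.keys q"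
      using Poly_Mapping.keys_mult[of p q] by blast
    thus "Poly_Mapping.keys e \<subseteq> J"
      using pq Poly_Mapping.keys_add[of a b] unfolding polys_in_def by blast
  qed
  moreover have "- p \<in> polys_in J" if "p \<in> polys_in J" for p
    using that by (auto simp: polys_in_def in_keys_iff)
  moreover have "0 \<in> polys_in J" "1 \<in> polys_in J" by (simp_all add: polys_in_def)
  ultimately show ?thesis by - (rule is_subringI)
qed

lemma is_subring_image_poly_eval: "is_subring (poly_eval x ` polys_in J)"
proof -
  note C = subring_closed[OF is_subring_polys_in[of J]]
  have "0 \<in> poly_eval x ` polys_in J" using C(1) by (force simp: poly_eval_zero)
  moreover have "1 \<in> poly_eval x ` polys_in J"
    using C(2) poly_eval_single[of x 0 1] by (force simp: monomial_eval_def)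
  moreover have "a + b \<in> poly_eval x ` polys_in J" "a * b \<in> poly_eval x ` polys_in J"
    if "a \<in> poly_eval x ` polys_in J" "b \<in> poly_eval x ` polys_in J" for a b
    using that C(3,4) by (auto simp flip: poly_eval_add poly_eval_mult)
  moreover have "- a \<in> poly_eval x ` polys_in J" if "a \<in> poly_eval x ` polys_in J" for a
    using that C(5) by (auto simp flip: poly_eval_uminus)
  ultimately show ?thesis by - (rule is_subringI)
qed

lemma single_var_in_polys_in: "i \<in> J \<Longrightarrow> Poly_Mapping.single (Poly_Mapping.single i a) c \<in> polys_in J"
  by (simp add: polys_in_def)

lemma poly_eval_var: "poly_eval x (Poly_Mapping.single (Poly_Mapping.single i a) 1) = x i ^ a"
  using monomial_eval_superset[of "{i}" "Poly_Mapping.single i a" x] by (simp add: poly_eval_single)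

lemma algebraically_independentD:
  "algebraically_independent n x \<Longrightarrow> p \<in> polys_in {1..n} \<Longrightarrow> poly_eval x p = 0 \<Longrightarrow> p = 0"
  unfolding algebraically_independent_def polys_in_def by blast

text \<open>A power of the product of the other variables turns a relation for \<open>x k\<close>
  into a polynomial relation \<open>Q\<close>. Its terms are told apart by their exponent at
  \<open>k\<close>, so all coefficients vanish.\<close>

lemma independent_on_if_algebraically_independent:
  fixes x :: "nat \<Rightarrow> 'a::field_char_0"
  assumes x: "algebraically_independent n x"
  shows "independent_on {1..n} x"
  unfolding independent_on_def transc_over_def
proof (intro ballI impI)
  fix k p assume k: "k \<in> {1..n}" and p: "p \<in> polys_over (laurent_on ({1..n} - {k}) x)" "poly p (x k) = 0"
  let ?J = "{1..n} - {k}"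
  let ?S = "poly_eval x ` polys_in ?J"
  have S: "is_subring ?S" by (rule is_subring_image_poly_eval)
  have x0: "x i \<noteq> 0" if "i \<in> {1..n}" for i
  proof
    assume "x i = 0"
    hence "poly_eval x (Poly_Mapping.single (Poly_Mapping.single i 1) 1) = 0"
      using poly_eval_var[of x i 1] by simp
    hence "Poly_Mapping.single (Poly_Mapping.single i (1::nat)) (1::rat) = 0"
      by (rule algebraically_independentD[OF x single_var_in_polys_in[OF that]])
    hence "Poly_Mapping.lookup (Poly_Mapping.single (Poly_Mapping.single i (1::nat)) (1::rat)) (Poly_Mapping.single i 1) = 0"
      by simp
    thus False by (simp only: lookup_single_eq one_neq_zero)
  qed
  have xS: "x i \<in> ?S" if "i \<in> ?J" for i
    using single_var_in_polys_in[OF that, of 1 1] poly_eval_var[of x i 1] by force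
  define g where "g = (\<Prod>i\<in>?J. x i)"
  have g: "g \<in> ?S" "g \<noteq> 0"
    unfolding g_def using x0 by (auto simp del: atLeastAtMost_iff One_nat_def intro!: subring_prod S xS)
  define d where "d = degree p"
  have "\<exists>N. coeff p i * g ^ N \<in> ?S" for i
  proof -
    have "g \<in> denominators ?S (coeff p i)"
      unfolding g_def using x0 xS
      by (intro prod_in_denominators[of ?S ?J x ?J] S polys_overD[OF p(1)]) auto
    thus ?thesis by (auto simp: denominators_def)
  qed
  then obtain N where N: "\<And>i. coeff p i * g ^ N i \<in> ?S" by metis
  define M where "M = (\<Sum>i\<le>d. N i)"
  have "\<exists>q\<in>polys_in ?J. coeff p i * g ^ M = poly_eval x q" if "i \<le> d" for i
  proof -
    have "N i \<le> M" unfolding M_def using that by (intro member_le_sum) auto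
    hence "coeff p i * g ^ M = (coeff p i * g ^ N i) * g ^ (M - N i)"
      by (simp add: mult.assoc flip: power_add)
    also have "\<dots> \<in> ?S" using N g S by (simp only: subring_closed)
    finally show ?thesis by blast
  qed
  then obtain q where q: "\<And>i. i \<le> d \<Longrightarrow> q i \<in> polys_in ?J"
    "\<And>i. i \<le> d \<Longrightarrow> coeff p i * g ^ M = poly_eval x (q i)" by metis
  define X :: "nat \<Rightarrow> (nat \<Rightarrow>\<^sub>0 nat) \<Rightarrow>\<^sub>0 rat" where
    "X i = Poly_Mapping.single (Poly_Mapping.single k i) 1" for i
  define Q where "Q = (\<Sum>i\<le>d. q i * X i)"
  have "Q \<in> polys_in {1..n}"
  proof -
    have "polys_in ?J \<subseteq> polys_in {1..n}" unfolding polys_in_def by blast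
    thus ?thesis unfolding Q_def X_def using q(1)
      by (intro subring_sum is_subring_polys_in subring_closed(4)[OF is_subring_polys_in]
          single_var_in_polys_in[OF k]) auto
  qed
  moreover have "poly_eval x Q = 0"
  proof -
    have "poly_eval x Q = (\<Sum>i\<le>d. coeff p i * g ^ M * x k ^ i)"
      unfolding Q_def poly_eval_sum by (intro sum.cong) (auto simp: poly_eval_mult X_def poly_eval_var q(2))
    also have "\<dots> = poly p (x k) * g ^ M"
      unfolding poly_altdef d_def sum_distrib_right by (intro sum.cong) (auto simp: mult_ac)
    finally show ?thesis using p(2) by simp
  qed
  ultimately have Q0: "Q = 0" by (rule algebraically_independentD[OF x])
  have no_k: "Poly_Mapping.lookup e k = 0" if "r \<in> polys_in ?J" "e \<in> Poly_Mapping.keys r" for e r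
  proof -
    have "k \<notin> Poly_Mapping.keys e" using that unfolding polys_in_def by blast
    thus ?thesis by (simp add: in_keys_iff)
  qed
  have "coeff p i = 0" if i: "i \<le> d" for i
  proof -
    have "Poly_Mapping.lookup (q i) e = 0" for e
    proof (cases "e \<in> Poly_Mapping.keys (q i)")
      case True
      with q(1)[OF i] have ek: "Poly_Mapping.lookup e k = 0" by (rule no_k)
      \<comment> \<open>This exponent vector has entry \<open>i\<close> at \<open>k\<close>, so only
        the summand \<open>q i * X i\<close> of \<open>Q\<close> can contribute to it.\<close>
      let ?f = "e + Poly_Mapping.single k i"
      have other: "Poly_Mapping.lookup (q j * X j) ?f = 0" if j: "j \<le> d" "j \<noteq> i" for j
      proof (rule ccontr)
        assume "Poly_Mapping.lookup (q j * X j) ?f \<noteq> 0"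
        hence "?f \<in> Poly_Mapping.keys (q j * X j)" by (simp add: in_keys_iff)
        then obtain e' where e': "e' \<in> Poly_Mapping.keys (q j)" "?f = e' + Poly_Mapping.single k j"
          using Poly_Mapping.keys_mult[of "q j" "X j"] by (auto simp: X_def)
        have "Poly_Mapping.lookup e' k = 0"
          using q(1)[OF j(1)] e'(1) by (rule no_k)
        thus False using arg_cong[OF e'(2), of "\<lambda>f. Poly_Mapping.lookup f k"] ek j(2)
          by (simp add: lookup_add)
      qed
      have "0 = Poly_Mapping.lookup Q ?f" by (simp add: Q0)
      also have "\<dots> = (\<Sum>j\<le>d. Poly_Mapping.lookup (q j * X j) ?f)"
        by (simp add: Q_def lookup_sum)
      also have "\<dots> = (\<Sum>j\<in>{i}. Poly_Mapping.lookup (q j * X j) ?f)"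
        using i other by (intro sum.mono_neutral_right) auto
      also have "\<dots> = Poly_Mapping.lookup (q i) e"
        by (simp add: X_def lookup_mult_single_shift)
      finally show ?thesis ..
    qed (simp add: in_keys_iff)
    hence "q i = 0" by (intro poly_mapping_eqI) simp
    thus ?thesis using q(2)[OF i] g(2) by (simp add: poly_eval_zero)
  qed
  thus "p = 0" by (metis d_def leading_coeff_0_iff order_refl)
qed

lemma good_seed_if_ordered_seed: "ordered_seed n m s \<Longrightarrow> good_seed n m s"
  using independent_on_if_algebraically_independent
  by (auto simp: ordered_seed_def good_seed_def freely_generates_field_def)

subsection \<open>Laurent polynomials in one variable\<close>

text \<open>That is, \<open>K[w\<^sup>\<plusminus>\<^sup>1] \<inter> K[(Q/w)\<^sup>\<plusminus>\<^sup>1] = K[w, Q/w]\<close>.\<close>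

lemma laurent_adj_Int_quotient:
  assumes K: "is_subring K" and w: "transc_over K w" and Q: "Q \<in> K" "Q \<noteq> 0"
    and u: "u \<in> laurent_adj K w" "u \<in> laurent_adj K (Q * inverse w)"
    and T: "is_subring T" "K \<subseteq> T" "w \<in> T" "Q * inverse w \<in> T"
  shows "u \<in> T"
proof -
  define v where "v = Q * inverse w"
  note w0 = transc_over_nonzero[OF K w]
  note CK = subring_closed[OF K] and CT = subring_closed[OF T(1)]
  have vw: "v * w = Q" using w0 by (simp add: v_def)
  \<comment> \<open>The induction on the bound \<open>N\<close> for the pole order subtracts the
    polar term \<open>a * v ^ Suc N\<close> with \<open>a\<close> in \<open>K\<close>; hence
    \<open>u\<close> and \<open>p\<close> vary.\<close>
  have "u \<in> T" if "p \<in> polys_over K" "u * w ^ N = poly p w" "u \<in> laurent_adj K v" for N p u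
    using that
  proof (induction N arbitrary: p u)
    case 0
    thus ?case using poly_in_subring[OF T(1,2) _ T(3)] by simp
  next
    case (Suc N)
    obtain M q where q: "q \<in> polys_over K" "u * v ^ M = poly q v"
      using Suc.prems(3) by (auto simp: laurent_adj_def)
    obtain r where r: "r \<in> polys_over K" "poly r w = poly q v * w ^ degree q"
      "\<And>i. i \<le> degree q \<Longrightarrow> coeff r (degree q - i) = coeff q i * Q ^ i"
      using poly_reverse_quotient[OF K Q(1) q(1) w0] unfolding v_def by blast
    define d where "d = degree q"
    define e where "e = M + Suc N"
    have "poly (monom (Q ^ M) d * p) w = (v * w) ^ M * w ^ d * (u * w ^ Suc N)"
      unfolding Suc.prems(2) vw by (simp add: poly_monom)
    also have "\<dots> = (u * v ^ M) * w ^ d * w ^ e"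
      by (simp add: e_def power_mult_distrib power_add algebra_simps)
    also have "\<dots> = poly (monom 1 e * r) w"
      by (simp add: poly_monom r(2) q(2) d_def)
    finally have "monom (Q ^ M) d * p = monom 1 e * r"
      by (intro transc_over_unique[OF K w] subring_closed(4)[OF is_subring_polys_over[OF K]]
          polys_over_monom K Suc.prems(1) r(1) CK Q(1))
    from arg_cong[OF this, of "\<lambda>p. coeff p d"]
    have c: "Q ^ M * coeff p 0 = (if d < e then 0 else coeff r (d - e))"
      by (simp add: coeff_monom_mult)
    \<comment> \<open>Comparing coefficients at \<open>d\<close> shows that the constant coefficient
      of \<open>p\<close> is divisible by \<open>Q ^ Suc N\<close> in \<open>K\<close>; for
      \<open>d < e\<close> both sides are zero.\<close>
    have "coeff p 0 = coeff q e * Q ^ Suc N"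
    proof (cases "d < e")
      case True
      thus ?thesis using c Q(2) by (simp add: coeff_eq_0 d_def)
    next
      case False
      hence "Q ^ M * coeff p 0 = Q ^ M * (coeff q e * Q ^ Suc N)"
        using c r(3)[of e] by (simp add: d_def e_def power_add)
      thus ?thesis using Q(2) by simp
    qed
    then obtain a where a: "a \<in> K" "coeff p 0 = a * Q ^ Suc N" using polys_overD[OF q(1)] by blast
    obtain c p' where p': "p = pCons c p'" by (rule pCons_cases)
    have c: "c = a * Q ^ Suc N" using a(2) by (simp add: p')
    define u' where "u' = u - a * v ^ Suc N"
    have "u' * w ^ Suc N = u * w ^ Suc N - a * (v * w) ^ Suc N"
      by (simp add: u'_def power_mult_distrib algebra_simps)
    also have "\<dots> = poly p' w * w" by (simp only: Suc.prems(2) vw c p') simp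
    finally have "u' * w ^ N = poly p' w" using w0 by simp
    moreover have "p' \<in> polys_over K"
      using Suc.prems(1) by (auto simp: polys_over_def p' coeff_pCons dest: spec[of _ "Suc _"])
    moreover have "u' \<in> laurent_adj K v"
      unfolding u'_def using Suc.prems(3) a(1) laurent_adj_contains(1,2)[OF K, of v]
      by (intro subring_closed(4,6,7)[OF is_subring_laurent_adj[OF K]]) auto
    ultimately have "u' \<in> T" by (intro Suc.IH)
    moreover have "a * v ^ Suc N \<in> T" using a(1) T(2,4) by (intro CT) (auto simp: v_def)
    ultimately have "u' + a * v ^ Suc N \<in> T" by (rule CT)
    thus ?case by (simp add: u'_def)
  qed
  thus ?thesis using u by (auto simp: laurent_adj_def[of K w] v_def)
qed

text \<open>The binomial has constant term 1, so after clearing powers of \<open>t\<close> each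
  coefficient of \<open>a\<close> is a multiple of \<open>g\<close> minus \<mu> times a lower
  coefficient. Divisibility by \<open>g\<close> spreads upwards from the lowest one.\<close>

lemma laurent_adj_cancel_monic:
  assumes K: "is_subring K" and t: "transc_over K t" and g: "g \<in> K" "g \<noteq> 0"
    and \<mu>: "\<mu> \<in> K" "b > 0" and ac: "a \<in> laurent_adj K t" "c \<in> laurent_adj K t"
    and eq: "(1 + \<mu> * t ^ b) * a = g * c"
  shows "a * inverse g \<in> laurent_adj K t"
proof -
  note CK = subring_closed[OF K]
  note CP = subring_closed[OF is_subring_polys_over[OF K]]
  obtain N p where p: "p \<in> polys_over K" "a * t ^ N = poly p t"
    using ac(1) by (auto simp: laurent_adj_def)
  obtain M q where q: "q \<in> polys_over K" "c * t ^ M = poly q t"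
    using ac(2) by (auto simp: laurent_adj_def)
  define p' where "p' = monom 1 M * p"
  define q' where "q' = monom 1 N * q"
  have p': "p' \<in> polys_over K" "a * t ^ (N + M) = poly p' t"
    unfolding p'_def using p CP(4) polys_over_monom[OF K CK(2)]
    by (auto simp: poly_monom power_add p(2)[symmetric] algebra_simps)
  have q': "q' \<in> polys_over K" "c * t ^ (N + M) = poly q' t"
    unfolding q'_def using q CP(4) polys_over_monom[OF K CK(2)]
    by (auto simp: poly_monom power_add q(2)[symmetric] algebra_simps)
  have "poly (p' + monom \<mu> b * p') t = ((1 + \<mu> * t ^ b) * a) * t ^ (N + M)"
    by (simp add: poly_monom p'(2)[symmetric] algebra_simps)
  also have "\<dots> = g * c * t ^ (N + M)" by (simp only: eq)
  also have "\<dots> = poly (monom g 0 * q') t"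
    by (simp add: poly_monom q'(2)[symmetric] algebra_simps)
  finally have "p' + monom \<mu> b * p' = monom g 0 * q'"
    using transc_over_unique[OF K t] CP(3,4) p'(1) q'(1) polys_over_monom[OF K] \<mu>(1) g(1)
    by metis
  from arg_cong[OF this, of "\<lambda>p. coeff p i" for i]
  have co: "coeff p' i + (if i < b then 0 else \<mu> * coeff p' (i - b)) = g * coeff q' i" for i
    by (simp add: coeff_monom_mult)
  have "coeff p' i * inverse g \<in> K" for i
  proof (induction i rule: less_induct)
    case (less i)
    show ?case
    proof (cases "i < b")
      case True
      hence "coeff p' i * inverse g = coeff q' i" using co[of i] g(2) by simp
      thus ?thesis using polys_overD[OF q'(1)] by simp
    next
      case False
      hence "coeff p' i = g * coeff q' i - \<mu> * coeff p' (i - b)" using co[of i] by (simp add: algebra_simps)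
      hence "coeff p' i * inverse g = coeff q' i - \<mu> * (coeff p' (i - b) * inverse g)"
        using g(2) by (simp add: field_simps)
      moreover have "coeff p' (i - b) * inverse g \<in> K" using less.IH[of "i - b"] False \<mu>(2) by simp
      ultimately show ?thesis using polys_overD[OF q'(1)] \<mu>(1) CK(4,6) by simp
    qed
  qed
  hence "smult (inverse g) p' \<in> polys_over K" by (simp add: polys_over_def mult.commute)
  thus ?thesis
    by (rule laurent_adjI[of _ _ _ _ "N + M"]) (simp add: p'(2)[symmetric] algebra_simps)
qed

text \<open>If \<open>g ^ l\<close> and the \<open>k\<close>-th power of the binomial clear
  \<open>u\<close>, then \<open>u * g ^ l\<close> times that power is divisible by
  \<open>g ^ l\<close>; the binomial factors are cancelled one at a time.\<close>

lemma laurent_adj_coprime_denominators: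
  assumes K: "is_subring K" and t: "transc_over K t" and g: "g \<in> K" "g \<noteq> 0"
    and \<mu>: "\<mu> \<in> K" "b > 0"
    and D: "g \<in> denominators (laurent_adj K t) u" "1 + \<mu> * t ^ b \<in> denominators (laurent_adj K t) u"
  shows "u \<in> laurent_adj K t"
proof -
  let ?S = "laurent_adj K t" and ?P = "1 + \<mu> * t ^ b"
  note CS = subring_closed[OF is_subring_laurent_adj[OF K, of t]]
  obtain l where l: "u * g ^ l \<in> ?S" using D(1) by (auto simp: denominators_def)
  obtain k where k: "u * ?P ^ k \<in> ?S" using D(2) by (auto simp: denominators_def)
  have P: "?P \<in> ?S" using D(2) by (auto simp: denominators_def)
  have gl: "g ^ l \<in> K" "g ^ l \<noteq> 0" using g subring_closed(7)[OF K] by auto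
  have "a * inverse (g ^ l) \<in> ?S" if "a \<in> ?S" "a * ?P ^ i * inverse (g ^ l) \<in> ?S" for a i
    using that(2)
  proof (induction i)
    case (Suc i)
    have "(a * ?P ^ i) * inverse (g ^ l) \<in> ?S"
    proof (rule laurent_adj_cancel_monic[OF K t gl \<mu>])
      show "a * ?P ^ i \<in> ?S" by (intro CS(4,7) that(1) P)
      show "a * ?P ^ Suc i * inverse (g ^ l) \<in> ?S" by (rule Suc.prems)
      show "?P * (a * ?P ^ i) = g ^ l * (a * ?P ^ Suc i * inverse (g ^ l))"
        using gl(2) by (simp only: power_Suc) (simp add: field_simps)
    qed
    thus ?case by (rule Suc.IH)
  qed simp
  moreover have "u * g ^ l * ?P ^ k * inverse (g ^ l) = u * ?P ^ k"
    "u * g ^ l * inverse (g ^ l) = u"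
    using gl(2) by (simp_all add: field_simps)
  ultimately show ?thesis using l k by metis
qed

subsection \<open>Coprime binomials\<close>

lemma denominators_uminus:
  "is_subring S \<Longrightarrow> g \<in> denominators S u \<Longrightarrow> - g \<in> denominators S u"
  using denominators_mult[of S g u "-1"] subring_closed(2,5)[of S] by simp

lemma denominators_power_cong:
  assumes S: "is_subring S" and v: "v \<in> S" "1 + v \<in> denominators S u"
  shows "v ^ n - (-1) ^ n \<in> denominators S u"
proof (induction n)
  case 0
  thus ?case using is_ideal_denominators[OF S, of u] by (simp add: is_ideal_def)
next
  case (Suc n)
  note CS = subring_closed[OF S]
  have "v ^ Suc n - (-1) ^ Suc n = v * (v ^ n - (-1) ^ n) + (-1) ^ n * (1 + v)"
    by (simp add: algebra_simps)
  moreover have "(-1) ^ n \<in> S" by (intro CS)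
  ultimately show ?case
    using denominators_add[OF S denominators_mult[OF S Suc.IH v(1)] denominators_mult[OF S v(2)]]
    by simp
qed

text \<open>\<open>1 + inverse v\<close> is \<open>inverse v\<close> times \<open>1 + v\<close>,
  hence again a denominator, which settles negative exponents. Only the parity of \<open>a\<close>
  matters for the sign.\<close>

lemma denominators_powi_cong:
  fixes v :: "'a::field"
  assumes S: "is_subring S" and v: "v \<in> S" "inverse v \<in> S" "v \<noteq> 0" "1 + v \<in> denominators S u"
  shows "v powi a - (-1) ^ nat \<bar>a\<bar> \<in> denominators S u"
proof (cases "a \<ge> 0")
  case True
  thus ?thesis using denominators_power_cong[OF S v(1,4), of "nat a"] by (simp add: power_int_def)
next
  case False
  have "inverse v * (1 + v) = 1 + inverse v" using v(3) by (simp add: field_simps)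
  hence "1 + inverse v \<in> denominators S u" using denominators_mult[OF S v(4,2)] by simp
  thus ?thesis using denominators_power_cong[OF S v(2), of u "nat (- a)"] False by (simp add: power_int_def)
qed

text \<open>If \<open>X\<^sup>\<alpha> \<equiv> -1\<close> and \<open>X\<^sup>\<beta> \<equiv> -1\<close>, then \<open>X\<^sup>\<gamma> \<equiv> \<plusminus>1\<close> for \<open>\<gamma> = \<beta>\<^sub>p \<alpha> - \<alpha>\<^sub>p \<beta>\<close>, which eliminates the
  variable \<open>x\<^sub>p\<close>, while \<open>1 + X\<^sup>\<beta>\<close> is monic in \<open>x\<^sub>p\<close> up to a unit.\<close>

lemma laurent_coprime_binomials:
  assumes x: "independent_on I x" and I: "finite I" and p: "p \<in> I" "\<beta> p \<noteq> 0"
    and q: "q \<in> I" "\<alpha> q * \<beta> p \<noteq> \<beta> q * \<alpha> p"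
    and D: "1 + laurent_monomial I x \<alpha> \<in> denominators (laurent_on I x) u"
      "1 + laurent_monomial I x \<beta> \<in> denominators (laurent_on I x) u"
  shows "u \<in> laurent_on I x"
proof -
  let ?S = "laurent_on I x" and ?K = "laurent_on (I - {p}) x"
  note S = is_subring_laurent_on[of I x] and K = is_subring_laurent_on[of "I - {p}" x]
  note x0 = independent_on_nonzero[OF x]
  have m: "laurent_monomial I x e \<in> ?S" "inverse (laurent_monomial I x e) \<in> ?S"
    "laurent_monomial I x e \<noteq> 0" for e
    using laurent_monomial_in[of I I e x] laurent_monomial_in[of I I "\<lambda>i. - e i" x]
      laurent_monomial_nonzero[of I x e] I x0 by (auto simp: laurent_monomial_minus)
  define c where "c a = ((-1) ^ nat \<bar>a\<bar> :: 'a)" for a :: int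
  have c: "c a \<in> laurent_on J x" for a J unfolding c_def by (intro laurent_on_closed)
  have 1: "laurent_monomial I x (\<lambda>i. \<alpha> i * \<beta> p) - c (\<beta> p) \<in> denominators ?S u"
    using denominators_powi_cong[OF S m D(1), of "\<beta> p"] by (simp add: laurent_monomial_powi c_def)
  have 2: "laurent_monomial I x (\<lambda>i. \<beta> i * - \<alpha> p) - c (- \<alpha> p) \<in> denominators ?S u"
    using denominators_powi_cong[OF S m D(2), of "- \<alpha> p"] by (simp add: laurent_monomial_powi c_def)
  define \<gamma> where "\<gamma> i = \<alpha> i * \<beta> p + \<beta> i * - \<alpha> p" for i
  define g where "g = laurent_monomial I x \<gamma> - c (\<beta> p) * c (- \<alpha> p)"
  have "laurent_monomial I x \<gamma> = laurent_monomial I x (\<lambda>i. \<alpha> i * \<beta> p) * laurent_monomial I x (\<lambda>i. \<beta> i * - \<alpha> p)"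
    unfolding \<gamma>_def using x0 by (rule laurent_monomial_add)
  hence "g = laurent_monomial I x (\<lambda>i. \<alpha> i * \<beta> p) * (laurent_monomial I x (\<lambda>i. \<beta> i * - \<alpha> p) - c (- \<alpha> p)) +
      c (- \<alpha> p) * (laurent_monomial I x (\<lambda>i. \<alpha> i * \<beta> p) - c (\<beta> p))"
    by (simp add: g_def algebra_simps)
  hence gD: "g \<in> denominators ?S u"
    using denominators_add[OF S denominators_mult[OF S 2 m(1)] denominators_mult[OF S 1 c]] by simp
  have gK: "g \<in> ?K"
    unfolding g_def by (intro laurent_on_closed laurent_monomial_in c) (auto simp: \<gamma>_def)
  \<comment> \<open>By the choice of \<open>q\<close>, the monomial has a nonzero exponent at
    \<open>x q\<close> and so cannot equal a sign.\<close>
  have g0: "g \<noteq> 0"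
  proof
    assume "g = 0"
    hence "laurent_monomial I x \<gamma> = c (\<beta> p) * c (- \<alpha> p)" by (simp add: g_def)
    also have "\<dots> \<in> laurent_on (I - {q}) x" by (intro laurent_on_closed c)
    finally show False using laurent_monomial_notin[OF x I q(1), of \<gamma>] q(2) by (simp add: \<gamma>_def)
  qed
  \<comment> \<open>The cancellation lemma asks for a positive exponent at \<open>p\<close>;
    multiplying the binomial by the inverse monomial negates \<beta> if necessary.\<close>
  obtain \<beta>' where \<beta>': "\<beta>' p > 0" "1 + laurent_monomial I x \<beta>' \<in> denominators ?S u"
  proof (cases "\<beta> p > 0")
    case True
    thus ?thesis using that D(2) by blast
  next
    case False
    have "inverse (laurent_monomial I x \<beta>) * (1 + laurent_monomial I x \<beta>) =
        1 + laurent_monomial I x (\<lambda>i. - \<beta> i)"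
      using m(3)[of \<beta>] unfolding laurent_monomial_minus[symmetric] by (simp add: field_simps)
    thus ?thesis using that[of "\<lambda>i. - \<beta> i"] denominators_mult[OF S D(2) m(2)[of \<beta>]] False p(2) by simp
  qed
  have "laurent_monomial I x \<beta>' = laurent_monomial I x (\<beta>'(p := 0)) * x p ^ nat (\<beta>' p)"
    using laurent_monomial_remove[OF I p(1), of x \<beta>'] \<beta>'(1) by (simp add: power_int_def)
  moreover have "laurent_monomial I x (\<beta>'(p := 0)) \<in> ?K" by (intro laurent_monomial_in) auto
  moreover have SK: "?S = laurent_adj ?K (x p)" using p(1) x0[OF p(1)] by (rule laurent_on_remove)
  ultimately show ?thesis
    using laurent_adj_coprime_denominators[OF K independent_onD[OF x p(1)] gK g0, of _ "nat (\<beta>' p)" u] \<beta>' gD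
    by simp
qed

subsection \<open>Two consecutive mutations\<close>

text \<open>The only generator possibly outside \<open>L\<close> is the inverse of
  \<open>x k\<close>, and one factor \<open>P\<close> brings it into \<open>L\<close>. The separate
  name \<open>z\<close> lets the rule match updated clusters.\<close>

lemma laurent_on_exchange_denominator:
  assumes L: "is_subring L" and k: "k \<in> I" and P: "P \<in> L" "P \<noteq> 0"
    and R: "\<And>i. i \<in> I - {k} \<Longrightarrow> x i \<in> L" "\<And>i. i \<in> I - {k} \<Longrightarrow> inverse (x i) \<in> L"
    and z: "z \<in> L" "P * inverse z \<in> L" and xk: "x k = z"
    and u: "u \<in> laurent_on I x"
  shows "P \<in> denominators L u"
proof -
  have "laurent_on I x \<subseteq> {u. \<exists>N. u * P ^ N \<in> L}"
  proof (rule laurent_on_least[OF is_subring_localization[OF L P(1)]])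
    fix i assume i: "i \<in> I"
    have "a \<in> L \<Longrightarrow> a \<in> {u. \<exists>N. u * P ^ N \<in> L}" for a by (auto intro!: exI[of _ 0])
    moreover have "inverse z \<in> {u. \<exists>N. u * P ^ N \<in> L}"
      using z(2) by (auto intro!: exI[of _ 1] simp: mult.commute)
    ultimately show "x i \<in> {u. \<exists>N. u * P ^ N \<in> L}" "inverse (x i) \<in> {u. \<exists>N. u * P ^ N \<in> L}"
      using R[of i] z(1) xk i by (cases "i = k"; blast)+
  qed
  thus ?thesis using u P(1) by (auto simp: denominators_def)
qed

lemma power_diff_multiple:
  assumes S: "is_subring S" and q: "q \<in> S" "s \<in> S"
  shows "\<exists>h\<in>S. (q + s) ^ n = q ^ n + s * h"
proof (induction n)
  case 0
  thus ?case using subring_closed(1)[OF S] by (auto intro!: bexI[of _ 0])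
next
  case (Suc n)
  then obtain h where h: "h \<in> S" "(q + s) ^ n = q ^ n + s * h" by blast
  have "(q + s) ^ Suc n = q ^ Suc n + s * (q ^ n + (q + s) * h)"
    by (simp add: h(2) algebra_simps)
  moreover have "q ^ n + (q + s) * h \<in> S" using q h by (intro subring_closed(3,4,7)[OF S])
  ultimately show ?case by blast
qed

lemma exchange_binomial_normalized:
  assumes "\<And>i. i \<in> {1..n} \<Longrightarrow> x i \<noteq> 0"
  shows "inverse (laurent_monomial {1..n} x (\<lambda>i. max 0 (- B i k))) * exchange_binomial n x B k =
    1 + laurent_monomial {1..n} x (\<lambda>i. B i k)"
proof -
  have "laurent_monomial {1..n} x (\<lambda>i. max 0 (- B i k)) \<noteq> 0"
    by (rule laurent_monomial_nonzero) (use assms in auto)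
  thus ?thesis
    by (subst exchange_binomial_factor[of n x B k]) (use assms in \<open>simp_all flip: mult.assoc\<close>)
qed

lemma mutate_twice:
  assumes "j \<noteq> k"
  shows "fst (mutate n j (mutate n k (x, B))) =
    (let x' = x(k := exchange_binomial n x B k * inverse (x k))
     in x'(j := exchange_binomial n x' (mutate_matrix k B) j * inverse (x j)))"
  using assms by (simp add: mutate_eq Let_def)

text \<open>The target is the Laurent ring \<open>L\<close> of the cluster \<open>y\<close>, reached
  by mutating at \<open>k\<close> and then at \<open>j\<close>; \<open>x'\<close> is the cluster in
  between.\<close>

locale two_mutations =
  fixes n m j k :: nat and x :: "nat \<Rightarrow> 'a::field_char_0" and B :: "nat \<Rightarrow> nat \<Rightarrow> int"
  assumes good: "good_seed n m (x, B)" and mn: "m \<le> n"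
    and j: "j \<in> {1..m}" and k: "k \<in> {1..m}" and jk: "j \<noteq> k"
begin

abbreviation "I \<equiv> {1..n}"
abbreviation "Pk \<equiv> exchange_binomial n x B k"
abbreviation "Pj \<equiv> exchange_binomial n x B j"
abbreviation "x' \<equiv> x(k := Pk * inverse (x k))"
abbreviation "B' \<equiv> mutate_matrix k B"
abbreviation "Pj' \<equiv> exchange_binomial n x' B' j"
abbreviation "y \<equiv> x'(j := Pj' * inverse (x j))"

lemma jkI: "j \<in> I" "k \<in> I" using j k mn by auto

lemma B: "skew_symmetrizable m B" and indep_x: "independent_on I x"
  using good by (simp_all add: good_seed_def)

lemma diag: "B j j = 0" "B k k = 0" "B' j j = 0"
proof -
  show "B j j = 0" "B k k = 0" using skew_symmetrizable_sign(1)[OF B] j k by blast+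
  show "B' j j = 0"
    using skew_symmetrizable_sign(1)[OF skew_symmetrizable_mutate[OF B k] j j] .
qed

lemma y_eq: "fst (mutate n j (mutate n k (x, B))) = y"
  using mutate_twice[OF jk] by (simp add: Let_def)

lemma good_y: "good_seed n m (mutate n j (mutate n k (x, B)))"
  using good j k mn by (intro good_seed_mutate)

lemma good_x': "good_seed n m (x', B')"
  using good_seed_mutate[OF good k mn] by (simp add: mutate_eq)

lemma indep_y: "independent_on I y"
  using good_y y_eq[symmetric] by (cases "mutate n j (mutate n k (x, B))") (simp add: good_seed_def)

lemma indep_x': "independent_on I x'"
  using good_x' by (simp add: good_seed_def)

lemma x0: "i \<in> I \<Longrightarrow> x i \<noteq> 0"
  by (rule independent_on_nonzero[OF indep_x])

lemma P0: "Pk \<noteq> 0" "Pj \<noteq> 0" "Pj' \<noteq> 0"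
  using exchange_binomial_nonzero[OF indep_x] exchange_binomial_nonzero[OF indep_x'] by blast+

abbreviation "L \<equiv> laurent_on I y"

lemmas L_closed = laurent_on_closed[where I = I and x = y]

lemma laurent_on_y: "J \<subseteq> I - {j, k} \<Longrightarrow> laurent_on J x \<subseteq> L"
proof -
  assume J: "J \<subseteq> I - {j, k}"
  hence "laurent_on J x = laurent_on J y" by (intro laurent_on_cong) auto
  also have "\<dots> \<subseteq> L" using J by (intro laurent_on_mono) blast
  finally show ?thesis .
qed

lemma laurent_on_x'_y: "laurent_on (I - {j}) x' \<subseteq> L"
proof -
  have "laurent_on (I - {j}) x' = laurent_on (I - {j}) y" by (intro laurent_on_cong) auto
  also have "\<dots> \<subseteq> L" by (intro laurent_on_mono) blast
  finally show ?thesis .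
qed

lemma in_L:
  "i \<in> I - {j, k} \<Longrightarrow> x i \<in> L" "i \<in> I - {j, k} \<Longrightarrow> inverse (x i) \<in> L"
  "Pk * inverse (x k) \<in> L" "inverse (Pk * inverse (x k)) \<in> L"
  "Pj' * inverse (x j) \<in> L" "inverse (Pj' * inverse (x j)) \<in> L"
  using laurent_on_gen[of i I y] laurent_on_gen[of k I y] laurent_on_gen[of j I y] jk jkI by simp_all

lemma monomial_in_L: "laurent_monomial I x e \<in> L" if "e j = 0" "e k = 0"
proof -
  have "laurent_monomial I x e \<in> laurent_on (I - {j, k}) x"
    using that by (intro laurent_monomial_in) auto
  thus ?thesis using laurent_on_y[of "I - {j, k}"] by blast
qed

text \<open>\<open>x j\<close> is \<open>Pj'\<close> divided by \<open>y j\<close>, and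
  \<open>Pj'\<close> omits the variable at \<open>j\<close> because the diagonal of
  \<open>B'\<close> vanishes.\<close>

lemma xj_in_L: "x j \<in> L"
proof -
  have "Pj' \<in> laurent_on (I - {j}) x'" using diag(3) by (intro exchange_binomial_in) auto
  hence "Pj' * inverse (Pj' * inverse (x j)) \<in> L"
    using laurent_on_x'_y in_L(6) laurent_on_closed(4) by blast
  moreover have "Pj' * inverse (Pj' * inverse (x j)) = x j" using P0(3) x0[OF jkI(1)] by simp
  ultimately show ?thesis by (simp only:)
qed

lemma xk_in_L: "x k \<in> L" if "Pk \<in> L"
proof -
  have "Pk * inverse (Pk * inverse (x k)) \<in> L" using that in_L(4) by (rule laurent_on_closed)
  moreover have "Pk * inverse (Pk * inverse (x k)) = x k" using P0(1) x0[OF jkI(2)] by simp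
  ultimately show ?thesis by (simp only:)
qed

text \<open>Here \<open>P\<^sub>j\<close> and \<open>P\<^sub>k\<close> are both denominators of \<open>u\<close>, and coprime since the two columns are independent.\<close>

lemma step_unlinked:
  assumes u: "u \<in> laurent_on I x'" "u \<in> laurent_on I (x(j := Pj * inverse (x j)))"
    and B0: "B k j = 0" and cop: "coprime_seed n m (x, B)"
  shows "u \<in> L"
proof -
  have B0': "B j k = 0" using skew_symmetrizable_sign(3)[OF B k j] B0 by simp
  \<comment> \<open>With \<open>B k j = 0\<close>, the mutation at \<open>k\<close> changes neither
    column \<open>j\<close> nor any variable occurring in \<open>Pj\<close>.\<close>
  have "B' i j = B i j" if "i \<noteq> k" for i
    using that jk B0 by (simp add: mutate_matrix_def)
  moreover have "B' k j = 0" using B0 by (simp add: mutate_matrix_def)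
  ultimately have Pj': "Pj' = Pj"
    using B0 by (intro exchange_binomial_cong) (metis, metis fun_upd_other)
  have PL: "Pk \<in> L" "Pj \<in> L"
    using laurent_on_y[of "I - {j, k}"] diag B0 B0'
      exchange_binomial_in[of n "I - {j, k}" B k x] exchange_binomial_in[of n "I - {j, k}" B j x]
    by auto
  note S = is_subring_laurent_on[of I y]
  \<comment> \<open>\<open>x'\<close> differs from \<open>y\<close> only at \<open>j\<close>, and
    \<open>y j\<close> is \<open>Pj * inverse (x j)\<close>. In the next claim the other mutated
    cluster differs from \<open>y\<close> only at \<open>k\<close>.\<close>
  have "Pj \<in> denominators L u"
    by (rule laurent_on_exchange_denominator[OF S jkI(1) PL(2) P0(2) _ _ xj_in_L _ _ u(1)])
       (use in_L jk Pj' in auto)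
  moreover have "Pk \<in> denominators L u"
    by (rule laurent_on_exchange_denominator[OF S jkI(2) PL(1) P0(1) _ _ xk_in_L[OF PL(1)] _ _ u(2)])
       (use in_L jk Pj' in auto)
  moreover have "1 + laurent_monomial I y (\<lambda>i. B i l) \<in> denominators L u"
    if P: "exchange_binomial n x B l \<in> denominators L u" and z: "B j l = 0" "B k l = 0" for l
  proof -
    let ?M = "laurent_monomial I x (\<lambda>i. max 0 (- B i l))"
    have "inverse ?M \<in> L"
      unfolding laurent_monomial_minus by (rule monomial_in_L) (simp_all add: z)
    hence "inverse ?M * exchange_binomial n x B l \<in> denominators L u"
      by (rule denominators_mult[OF S P])
    moreover have "inverse ?M * exchange_binomial n x B l = 1 + laurent_monomial I x (\<lambda>i. B i l)"
      by (rule exchange_binomial_normalized) (rule x0)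
    ultimately have "1 + laurent_monomial I x (\<lambda>i. B i l) \<in> denominators L u" by (simp only:)
    moreover have "laurent_monomial I x (\<lambda>i. B i l) = laurent_monomial I y (\<lambda>i. B i l)"
      using z by (intro laurent_monomial_cong) auto
    ultimately show ?thesis by simp
  qed
  ultimately have D: "1 + laurent_monomial I y (\<lambda>i. B i k) \<in> denominators L u"
    "1 + laurent_monomial I y (\<lambda>i. B i j) \<in> denominators L u"
    using diag B0 B0' by auto
  have cop': "a = 0 \<and> b = 0" if h: "\<And>i. i \<in> I \<Longrightarrow> a * B i k + b * B i j = 0" for a b :: int
  proof -
    have "rat_of_int a * rat_of_int (B i k) + rat_of_int b * rat_of_int (B i j) = 0" if "i \<in> I" for i
      using h[OF that] by (metis of_int_0 of_int_add of_int_mult)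
    hence "\<forall>i\<in>I. rat_of_int a * rat_of_int (B i k) + rat_of_int b * rat_of_int (B i j) = 0" ..
    hence "rat_of_int a = 0 \<and> rat_of_int b = 0"
      by (rule cop[unfolded coprime_seed_def prod.case, THEN bspec, OF k, THEN bspec, OF j,
            THEN mp, OF jk[symmetric], THEN spec, THEN spec, THEN mp])
    thus ?thesis by simp
  qed
  \<comment> \<open>The coefficients 0, 1 give a nonzero entry of column \<open>j\<close>; the
    coefficients \<open>B p j\<close>, \<open>- B p k\<close> then give a nonvanishing minor in rows
    \<open>p\<close> and \<open>q\<close>.\<close>
  obtain p where p: "p \<in> I" "B p j \<noteq> 0" using cop'[of 0 1] by auto
  obtain q where q: "q \<in> I" "B p j * B q k + (- B p k) * B q j \<noteq> 0"
    using cop'[of "B p j" "- B p k"] p(2) by blast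
  show ?thesis
  proof (rule laurent_coprime_binomials[where \<alpha> = "\<lambda>i. B i k" and \<beta> = "\<lambda>i. B i j"])
    show "independent_on I y" by (rule indep_y)
    show "B q k * B p j \<noteq> B q j * B p k" using q(2) by (simp add: mult.commute)
  qed (use p q D in auto)
qed

text \<open>
  Here \<open>P\<^sub>k = q + r x\<^sub>j\<^sup>b\<close> with \<open>q\<close> a unit, so the denominators \<open>P\<^sub>k\<close> and \<open>x\<^sub>j\<close> generate the unit ideal. That
  \<open>P\<^sub>k\<close> is a denominator uses that \<open>P\<^sub>j / x\<^sub>j\<close> is a Laurent polynomial in the doubly mutated cluster
  (the fact \<open>wL\<close> below), by the congruence \<open>P\<^sub>k\<^sup>c \<equiv> q\<^sup>c\<close> modulo \<open>x\<^sub>j\<close>.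
\<close>

lemma step_linked_pos:
  assumes u: "u \<in> laurent_on I x" "u \<in> laurent_on I x'" "u \<in> laurent_on I (x(j := Pj * inverse (x j)))"
    and Bpos: "B k j > 0"
  shows "u \<in> L"
proof -
  note S = is_subring_laurent_on[of I y]
  have Bneg: "B j k < 0" using skew_symmetrizable_sign(2)[OF B j k] Bpos by simp
  define b where "b = nat (- B j k)"
  define c where "c = nat (B k j)"
  have bc: "b > 0" "c > 0" "B j k = - int b" "B k j = int c"
    using Bneg Bpos by (simp_all add: b_def c_def)
  define q where "q = laurent_monomial I x (\<lambda>i. max 0 (B i k))"
  define r where "r = laurent_monomial I x ((\<lambda>i. max 0 (- B i k))(j := 0))"
  define Y where "Y = laurent_monomial I x ((\<lambda>i. B i j)(k := 0))"
  define M where "M = laurent_monomial I x (\<lambda>i. max 0 (- B i j))"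
  define M' where "M' = laurent_monomial I x' (\<lambda>i. max 0 (- B' i j))"
  have qL: "q \<in> L" "inverse q \<in> L" and rL: "r \<in> L" and YL: "Y \<in> L" and MinL: "M \<in> L"
    unfolding q_def r_def Y_def M_def laurent_monomial_minus using diag Bneg Bpos jk
    by (auto intro: monomial_in_L simp del: One_nat_def)
  have q0: "q \<noteq> 0" unfolding q_def by (rule laurent_monomial_nonzero[OF _ x0]) simp_all
  have invM': "inverse M' \<in> L" "M' \<noteq> 0"
  proof -
    have "inverse M' \<in> laurent_on (I - {j}) x'"
      unfolding M'_def laurent_monomial_minus using diag(3) by (intro laurent_monomial_in) auto
    thus "inverse M' \<in> L" using laurent_on_x'_y by blast
    show "M' \<noteq> 0" unfolding M'_def
      by (rule laurent_monomial_nonzero[OF _ independent_on_nonzero[OF indep_x']]) auto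
  qed
  \<comment> \<open>\<open>B j k\<close> is negative, so \<open>x j\<close> occurs only in the
    second monomial of \<open>Pk\<close>; \<open>r\<close> is that monomial without it.\<close>
  have Pk: "Pk = q + r * x j ^ b"
    unfolding exchange_binomial_def q_def r_def
    using laurent_monomial_remove[of I j x "\<lambda>i. max 0 (- B i k)"] jkI bc
    by (simp add: power_int_def)
  have "q + r * x j ^ b \<in> L" by (intro L_closed(3,4,7) qL rL xj_in_L)
  hence PkL: "Pk \<in> L" unfolding Pk[symmetric] .
  have Pj: "Pj = M * (1 + Y * x k ^ c)"
    using exchange_binomial_factor[of n x B j] x0 laurent_monomial_remove[of I k x "\<lambda>i. B i j"] jkI bc
    by (simp add: M_def Y_def power_int_def)
  let ?z' = "Pk * inverse (x k)"
  \<comment> \<open>Since \<open>B k j = int c\<close> is positive, mutation at \<open>k\<close>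
    adds \<open>max 0 (B i k) * int c\<close> to the other entries of column \<open>j\<close>, which
    yields the factor \<open>q ^ c\<close>; the entry at \<open>k\<close> changes sign.\<close>
  have "laurent_monomial I x' (\<lambda>i. B' i j) =
      laurent_monomial I x' ((\<lambda>i. B' i j)(k := 0)) * ?z' powi (- int c)"
    using laurent_monomial_remove[of I k x' "\<lambda>i. B' i j"] jkI bc(4) by (simp add: mutate_matrix_def)
  also have "laurent_monomial I x' ((\<lambda>i. B' i j)(k := 0)) =
      laurent_monomial I x (\<lambda>i. ((\<lambda>i. B i j)(k := 0)) i + max 0 (B i k) * int c)"
  proof (intro laurent_monomial_cong)
    fix i
    show "((\<lambda>i. B' i j)(k := 0)) i = ((\<lambda>i. B i j)(k := 0)) i + max 0 (B i k) * int c"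
    proof (cases "i = k")
      case False
      have "2 * B' i j = 2 * B i j + (\<bar>B i k\<bar> + B i k) * int c"
        using mutate_matrix_double[OF False jk, of B] bc(4) by (simp add: algebra_simps)
      also have "\<bar>B i k\<bar> + B i k = 2 * max 0 (B i k)" by simp
      finally have "2 * B' i j = 2 * (B i j + max 0 (B i k) * int c)" by (simp add: algebra_simps)
      thus ?thesis using False by simp
    qed (simp add: diag)
  qed auto
  also have "\<dots> = Y * q ^ c"
    using laurent_monomial_powi[of I x "\<lambda>i. max 0 (B i k)" "int c"] x0
    by (subst laurent_monomial_add) (auto simp: Y_def q_def)
  also have "?z' powi (- int c) = inverse ?z' ^ c" by (simp only: power_int_minus power_int_of_nat power_inverse)
  finally have X': "laurent_monomial I x' (\<lambda>i. B' i j) = Y * q ^ c * inverse ?z' ^ c" .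
  have Pj': "Pj' = M' * (1 + Y * q ^ c * inverse ?z' ^ c)"
    using exchange_binomial_factor[of n x' B' j] independent_on_nonzero[OF indep_x']
    unfolding M'_def X' by blast
  have "r * x j ^ b \<in> L" by (intro L_closed(4,7) rL xj_in_L)
  then obtain h where h: "h \<in> L" "Pk ^ c = q ^ c + (r * x j ^ b) * h"
    using power_diff_multiple[OF S qL(1), of "r * x j ^ b" c] unfolding Pk[symmetric] by blast
  define Z where "Z = inverse ?z' ^ c"
  \<comment> \<open>This is \<open>Pj * inverse (x j)\<close> after inserting
    \<open>x k = Pk * inverse ?z'\<close> and the expansion of \<open>Pk ^ c\<close>. The part with
    \<open>q ^ c\<close> becomes \<open>inverse M' * Pj'\<close>; the rest contains a factor
    \<open>x j\<close>, which cancels.\<close>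
  define v where "v = M * (inverse M' * (Pj' * inverse (x j)) + Y * Z * r * x j ^ (b - 1) * h)"
  have "Z \<in> L" unfolding Z_def by (intro L_closed(7) in_L)
  hence v: "v \<in> L"
    unfolding v_def by (intro L_closed(3,4,7) MinL invM' in_L YL rL xj_in_L h)
  have xj0: "x j \<noteq> 0" and xk0: "x k \<noteq> 0" using x0 jkI by auto
  have "x k = Pk * inverse ?z'" using P0(1) xk0 by simp
  hence "x k ^ c = (q ^ c + (r * x j ^ b) * h) * Z"
    unfolding h(2)[symmetric] Z_def by (metis power_mult_distrib)
  also have "x j ^ b = x j * x j ^ (b - 1)" using bc(1) by (simp add: power_eq_if)
  finally have "Pj = M * ((1 + Y * q ^ c * Z) + Y * Z * r * x j ^ (b - 1) * h * x j)"
    unfolding Pj by (simp add: algebra_simps)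
  also have "1 + Y * q ^ c * Z = inverse M' * Pj'" unfolding Z_def using Pj' invM'(2) by simp
  finally have Pj_eq: "Pj = M * (inverse M' * Pj' + Y * Z * r * x j ^ (b - 1) * h * x j)" .
  have "Pj * inverse (x j) = v"
    unfolding v_def by (subst Pj_eq) (use xj0 in \<open>simp add: algebra_simps\<close>)
  hence wL: "Pj * inverse (x j) \<in> L" using v by simp
  note C = is_subring_localization[OF S PkL]
  \<comment> \<open>Being Laurent before and after the mutation at \<open>j\<close>,
    \<open>u\<close> is a polynomial in \<open>x j\<close> and \<open>Pj * inverse (x j)\<close>
    over the Laurent ring of the other variables. All of these lie in \<open>L\<close> up to powers
    of \<open>Pk\<close>.\<close>
  have "u \<in> {u. \<exists>N. u * Pk ^ N \<in> L}"
  proof (rule laurent_adj_Int_quotient[OF is_subring_laurent_on[of "I - {j}" x]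
        independent_onD[OF indep_x jkI(1)] _ P0(2) _ _ C])
    show "Pj \<in> laurent_on (I - {j}) x" using diag by (intro exchange_binomial_in) auto
    show "u \<in> laurent_adj (laurent_on (I - {j}) x) (x j)"
      using u(1) laurent_on_remove[OF jkI(1), of x] xj0 by simp
    have "laurent_on (I - {j}) x = laurent_on (I - {j}) (x(j := Pj * inverse (x j)))"
      by (intro laurent_on_cong) auto
    thus "u \<in> laurent_adj (laurent_on (I - {j}) x) (Pj * inverse (x j))"
      using u(3) laurent_on_remove[OF jkI(1), of "x(j := Pj * inverse (x j))"] xj0 P0(2) by simp
    have "Pk \<in> denominators L a" if "a \<in> laurent_on (I - {j}) x" for a
      by (rule laurent_on_exchange_denominator[OF S _ PkL P0(1) _ _ xk_in_L[OF PkL] in_L(3) _ that])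
         (use in_L jkI jk in auto)
    thus "laurent_on (I - {j}) x \<subseteq> {u. \<exists>N. u * Pk ^ N \<in> L}" by (auto simp: denominators_def)
    show "x j \<in> {u. \<exists>N. u * Pk ^ N \<in> L}" using xj_in_L by (auto intro!: exI[of _ 0])
    show "Pj * inverse (x j) \<in> {u. \<exists>N. u * Pk ^ N \<in> L}" using wL by (auto intro!: exI[of _ 0])
  qed
  hence 1: "Pk \<in> denominators L u" using PkL by (simp add: denominators_def)
  \<comment> \<open>Both \<open>P\<close> and \<open>z\<close> of the rule are taken to be
    \<open>x j\<close>, so their quotient is 1.\<close>
  have 2: "x j \<in> denominators L u"
    by (rule laurent_on_exchange_denominator[OF S jkI(1) xj_in_L xj0 _ _ xj_in_L _ _ u(2)])
       (use in_L jk xj0 laurent_on_closed(2)[of I y] in auto)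
  have "r * x j ^ (b - 1) \<in> L" by (intro L_closed rL xj_in_L)
  from denominators_mult[OF S 2 this] have "- (r * x j ^ (b - 1) * x j) \<in> denominators L u"
    by (rule denominators_uminus[OF S])
  from denominators_add[OF S 1 this] have "Pk + - (r * x j ^ (b - 1) * x j) \<in> denominators L u" .
  also have "Pk + - (r * x j ^ (b - 1) * x j) = q"
    by (subst Pk) (use bc(1) in \<open>simp add: power_eq_if mult_ac\<close>)
  finally have "q \<in> denominators L u" .
  from denominators_mult[OF S this qL(2)] have "1 \<in> denominators L u" using q0 by simp
  thus ?thesis by (rule denominators_one)
qed

end

subsection \<open>Invariance of the upper bound\<close>

definition upper_bound :: "nat \<Rightarrow> nat \<Rightarrow> 'a::field seed \<Rightarrow> 'a set" where
  "upper_bound n m s = laurent_ring n (fst s) \<inter> (\<Inter>k\<in>{1..m}. laurent_ring n (fst (mutate n k s)))"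

lemma skew_symmetrizable_uminus:
  assumes "skew_symmetrizable m B"
  shows "skew_symmetrizable m (\<lambda>i j. - B i j)"
proof -
  obtain d :: "nat \<Rightarrow> int" where d: "\<forall>i\<in>{1..m}. d i > 0"
    "\<forall>i\<in>{1..m}. \<forall>j\<in>{1..m}. d i * B i j = - (d j * B j i)"
    using assms unfolding skew_symmetrizable_def by blast
  show ?thesis unfolding skew_symmetrizable_def mult_minus_right neg_equal_iff_equal
    using d by blast
qed

lemma upper_bound_laurent_two_mutations:
  fixes s :: "'a::field_char_0 seed"
  assumes s: "good_seed n m s" "coprime_seed n m s" and mn: "m \<le> n"
    and jk': "j \<in> {1..m}" "k \<in> {1..m}" "j \<noteq> k" and u: "u \<in> upper_bound n m s"
  shows "u \<in> laurent_ring n (fst (mutate n j (mutate n k s)))"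
proof -
  obtain x B where xB: "s = (x, B)" by force
  interpret two_mutations n m j k x B
    using s(1) mn jk' by unfold_locales (simp_all add: xB)
  have ux: "u \<in> laurent_on I x" using u by (simp add: upper_bound_def laurent_ring_eq xB)
  have uk: "u \<in> laurent_on I x'"
    using u jk'(2) unfolding upper_bound_def laurent_ring_eq xB mutate_eq[symmetric]
    by (auto simp: mutate_eq)
  have uj: "u \<in> laurent_on I (x(j := Pj * inverse (x j)))"
    using u jk'(1) unfolding upper_bound_def laurent_ring_eq xB mutate_eq[symmetric]
    by (auto simp: mutate_eq)
  consider "B k j = 0" | "B k j > 0" | "B k j < 0" by linarith
  hence "u \<in> laurent_on I y"
  proof cases
    case 1
    thus ?thesis using step_unlinked[OF uk uj] s(2) by (simp add: xB)
  next
    case 2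
    thus ?thesis by (rule step_linked_pos[OF ux uk uj])
  next
    case 3
    \<comment> \<open>Negating the matrix changes no exchange binomial, before or after the mutation
      at \<open>k\<close>, and turns this case into the positive one.\<close>
    define C where "C = (\<lambda>i j. - B i j)"
    have "good_seed n m (x, C)"
      using good skew_symmetrizable_uminus unfolding good_seed_def prod.case C_def by blast
    then interpret neg: two_mutations n m j k x C
      using mn jk' by unfold_locales
    have eC: "exchange_binomial n x C l = exchange_binomial n x B l" for l
      unfolding C_def by (rule exchange_binomial_uminus)
    have "mutate_matrix k C = (\<lambda>i j. - mutate_matrix k B i j)"
      unfolding C_def by (intro ext mutate_matrix_uminus)
    hence eC': "exchange_binomial n z (mutate_matrix k C) l = exchange_binomial n z B' l" for z l
      by (simp only: exchange_binomial_uminus)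
    show ?thesis
      using neg.step_linked_pos[of u] ux uk uj 3 unfolding eC eC' by (simp add: C_def)
  qed
  thus ?thesis by (simp only: laurent_ring_eq xB y_eq)
qed

text \<open>A second mutation at \<open>k\<close> returns to \<open>s\<close>; at any other index
  the two-step lemma applies.\<close>

lemma upper_bound_mutate_subset:
  fixes s :: "'a::field_char_0 seed"
  assumes s: "good_seed n m s" "coprime_seed n m s" and mn: "m \<le> n" and k: "k \<in> {1..m}"
  shows "upper_bound n m s \<subseteq> upper_bound n m (mutate n k s)"
proof
  fix u assume u: "u \<in> upper_bound n m s"
  have "u \<in> laurent_ring n (fst (mutate n j (mutate n k s)))" if j: "j \<in> {1..m}" for j
  proof (cases "j = k")
    case True
    thus ?thesis using u mutate_involutive[OF s(1) k mn] by (simp add: upper_bound_def)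
  qed (rule upper_bound_laurent_two_mutations[OF s mn j k _ u])
  moreover have "u \<in> laurent_ring n (fst (mutate n k s))" using u k by (simp only: upper_bound_def) blast
  ultimately show "u \<in> upper_bound n m (mutate n k s)" by (simp only: upper_bound_def) blast
qed

lemma upper_bound_mutate:
  fixes s :: "'a::field_char_0 seed"
  assumes s: "good_seed n m s" "coprime_seed n m s" "coprime_seed n m (mutate n k s)"
    and mn: "m \<le> n" and k: "k \<in> {1..m}"
  shows "upper_bound n m (mutate n k s) = upper_bound n m s"
  using upper_bound_mutate_subset[OF s(1,2) mn k] mutate_involutive[OF s(1) k mn]
    upper_bound_mutate_subset[OF good_seed_mutate[OF s(1) k mn] s(3) mn k] by (intro equalityI) simp_all

lemma upper_bound_permute:
  fixes s :: "'a::field seed"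
  assumes \<sigma>: "\<sigma> permutes {1..n}" "\<sigma> ` {1..m} = {1..m}"
  shows "upper_bound n m (permute_seed \<sigma> s) = upper_bound n m s"
proof -
  obtain x B where s: "s = (x, B)" by force
  have L: "laurent_ring n (\<lambda>i. z (\<sigma> i)) = laurent_ring n z" for z :: "nat \<Rightarrow> 'a"
    unfolding laurent_ring_eq by (rule laurent_on_reindex[OF permutes_image[OF \<sigma>(1)]])
  have "laurent_ring n (fst (mutate n k (permute_seed \<sigma> s))) = laurent_ring n (fst (mutate n (\<sigma> k) s))" for k
  proof -
    have "fst (mutate n k (permute_seed \<sigma> s)) = (\<lambda>i. fst (mutate n (\<sigma> k) s) (\<sigma> i))"
      using permutes_inj[OF \<sigma>(1)]
      by (auto simp: s mutate_def permute_seed_def exchanged_var_permute[OF \<sigma>(1)] fun_eq_iff dest: injD)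
    thus ?thesis by (simp only: L)
  qed
  hence "(\<Inter>k\<in>{1..m}. laurent_ring n (fst (mutate n k (permute_seed \<sigma> s)))) =
      (\<Inter>k\<in>\<sigma> ` {1..m}. laurent_ring n (fst (mutate n k s)))" by simp
  moreover have "laurent_ring n (fst (permute_seed \<sigma> s)) = laurent_ring n (fst s)"
    by (simp add: s permute_seed_def L)
  ultimately show ?thesis by (simp only: upper_bound_def \<sigma>(2))
qed

lemma upper_bound_seeds_of:
  fixes s :: "'a::field_char_0 seed"
  assumes s: "good_seed n m s" "totally_coprime n m s" and mn: "m \<le> n" and t: "t \<in> seeds_of n m s"
  shows "good_seed n m t \<and> upper_bound n m t = upper_bound n m s"
proof -
  have "(seed_step n m)\<^sup>*\<^sup>* s t" using t by (simp add: seeds_of_def mutation_equivalent_def)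
  thus ?thesis
  proof (induction rule: rtranclp_induct)
    case base
    show ?case using s(1) by simp
  next
    case (step t t')
    have "coprime_seed n m t" "coprime_seed n m t'"
      using s(2) step.hyps(1) rtranclp.rtrancl_into_rtrancl[OF step.hyps]
      unfolding totally_coprime_def seeds_of_def mutation_equivalent_def by blast+
    with step.hyps(2) step.IH show ?case
      by cases (simp_all add: upper_bound_mutate good_seed_mutate mn upper_bound_permute good_seed_permute
          del: One_nat_def)
  qed
qed

text \<open>The mutations of \<open>t\<close> are seeds, which gives one inclusion. Conversely, the
  upper bounds of all seeds coincide, and each lies in the Laurent ring of its own cluster.\<close>

lemma upper_cluster_algebra_eq_upper_bound:
  fixes s :: "'a::field_char_0 seed"
  assumes s: "good_seed n m s" "totally_coprime n m s" and mn: "m \<le> n" and t: "t \<in> seeds_of n m s"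
  shows "upper_cluster_algebra n m s = upper_bound n m t"
proof
  have "mutate n k t \<in> seeds_of n m s" if "k \<in> {1..m}" for k
  proof -
    have "(seed_step n m)\<^sup>*\<^sup>* s t" using t by (simp add: seeds_of_def mutation_equivalent_def)
    from rtranclp.rtrancl_into_rtrancl[OF this seed_step.mutation[OF that]]
    show ?thesis by (simp only: seeds_of_def mutation_equivalent_def mem_Collect_eq)
  qed
  thus "upper_cluster_algebra n m s \<subseteq> upper_bound n m t"
    using t by (fastforce simp: upper_cluster_algebra_def upper_bound_def)
  have "upper_bound n m t \<subseteq> laurent_ring n (fst t')" if "t' \<in> seeds_of n m s" for t'
    using upper_bound_seeds_of[OF s mn t] upper_bound_seeds_of[OF s mn that]
    by (auto simp: upper_bound_def)
  thus "upper_bound n m t \<subseteq> upper_cluster_algebra n m s"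
    by (fastforce simp: upper_cluster_algebra_def)
qed

subsection \<open>The deep ideal\<close>

lemma mult_power_unit_in:
  fixes g :: "'a::field"
  assumes "is_subring L" "u * g ^ k \<in> L" "inverse g \<in> L" "g \<noteq> 0"
  shows "u \<in> L"
proof -
  have "u * g ^ k * inverse g ^ k \<in> L" using assms by (simp add: subring_closed)
  moreover have "u * g ^ k * inverse g ^ k = u" using assms(4) by (simp add: field_simps)
  ultimately show ?thesis by (simp only:)
qed

locale independent_seed =
  fixes n m :: nat and x :: "nat \<Rightarrow> 'a::field_char_0" and B :: "nat \<Rightarrow> nat \<Rightarrow> int"
  assumes good: "good_seed n m (x, B)" and mn: "m \<le> n"
begin

definition L where "L = lower_bound n m (x, B)"
definition U where "U = upper_bound n m (x, B)"
definition f where "f = (\<Prod>i\<in>{1..m}. x i)"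
definition h where "h k = exchanged_var n x B k * (\<Prod>i\<in>{1..m} - {k}. x i)"
abbreviation x' where "x' k \<equiv> x(k := exchanged_var n x B k)"

lemma mutable: "k \<in> {1..m} \<Longrightarrow> k \<in> {1..n}" using mn by auto

lemma indep_x': "independent_on {1..n} x" "k \<in> {1..m} \<Longrightarrow> independent_on {1..n} (x' k)"
  using good good_seed_mutate[OF good _ mn, of k] by (simp_all add: good_seed_def mutate_def)

lemma x0: "i \<in> {1..n} \<Longrightarrow> x i \<noteq> 0"
  by (rule independent_on_nonzero[OF indep_x'(1)])

lemma x'0: "k \<in> {1..m} \<Longrightarrow> exchanged_var n x B k \<noteq> 0"
  using independent_on_nonzero[OF indep_x'(2) mutable] by (metis fun_upd_same)

text \<open>The generator \<open>h k\<close> of the deep ideal is for the mutated cluster what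
  \<open>f\<close> is for \<open>x\<close>, hence a unit in the Laurent ring of
  \<open>x' k\<close>.\<close>

lemma h_eq: "k \<in> {1..m} \<Longrightarrow> h k = (\<Prod>i\<in>{1..m}. x' k i)"
  unfolding h_def by (subst prod.remove[of _ k]) auto

lemma f0: "f \<noteq> 0"
  unfolding f_def using x0[OF mutable] by (simp del: atLeastAtMost_iff One_nat_def)

lemma h0: "k \<in> {1..m} \<Longrightarrow> h k \<noteq> 0"
  unfolding h_def using x0[OF mutable] x'0 by (simp del: atLeastAtMost_iff One_nat_def)

lemma U_eq: "u \<in> U \<longleftrightarrow> u \<in> laurent_on {1..n} x \<and> (\<forall>k\<in>{1..m}. u \<in> laurent_on {1..n} (x' k))"
  by (simp add: U_def upper_bound_def laurent_ring_eq mutate_def del: One_nat_def)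

lemma subring_U: "is_subring U"
  by (rule is_subringI) (simp_all add: U_eq laurent_on_closed del: One_nat_def)

lemma subring_L: "is_subring L"
  by (simp add: L_def lower_bound_def is_subring_hull)

lemma L_gen:
  "i \<in> {1..n} \<Longrightarrow> x i \<in> L" "i \<in> {1..m} \<Longrightarrow> exchanged_var n x B i \<in> L"
  "i \<in> {m<..n} \<Longrightarrow> inverse (x i) \<in> L"
  unfolding L_def lower_bound_def prod.case by (intro hull_inc; blast)+

lemma exchanged_var_in:
  assumes T: "is_subring T" and xT: "\<And>i. i \<in> {1..n} \<Longrightarrow> x i \<in> T" "inverse (x k) \<in> T"
  shows "exchanged_var n x B k \<in> T"
  unfolding exchanged_var_def using xT
  by (intro subring_closed(3,4,7)[OF T] subring_prod T) auto

lemma x_in_laurent_x': "i \<in> {1..n} \<Longrightarrow> k \<in> {1..m} \<Longrightarrow> x i \<in> laurent_on {1..n} (x' k)"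
proof (cases "i = k")
  case True
  assume k: "k \<in> {1..m}"
  have "exchange_binomial n x B k \<in> laurent_on ({1..n} - {k}) x"
    using skew_symmetrizable_sign(1) k good by (intro exchange_binomial_in) (auto simp: good_seed_def)
  also have "laurent_on ({1..n} - {k}) x = laurent_on ({1..n} - {k}) (x' k)"
    by (intro laurent_on_cong) auto
  also have "\<dots> \<subseteq> laurent_on {1..n} (x' k)" by (rule laurent_on_mono) blast
  finally have "exchange_binomial n x B k * inverse (exchanged_var n x B k) \<in> laurent_on {1..n} (x' k)"
    using laurent_on_gen(2)[OF mutable[OF k], of "x' k"] by (simp add: laurent_on_closed del: One_nat_def)
  moreover have "exchange_binomial n x B k * inverse (exchanged_var n x B k) = x k"
    using x'0[OF k] by (auto simp: exchanged_var_eq)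
  ultimately show ?thesis using True by (simp only:)
next
  case False
  thus "i \<in> {1..n} \<Longrightarrow> x i \<in> laurent_on {1..n} (x' k)"
    using laurent_on_gen(1)[of i "{1..n}" "x' k"] by simp
qed

lemma L_subset_U: "L \<subseteq> U"
  unfolding L_def lower_bound_def prod.case
proof (intro hull_minimal subring_U Un_least image_subsetI)
  fix i assume i: "i \<in> {1..n}"
  show "x i \<in> U" unfolding U_eq using i laurent_on_gen(1) x_in_laurent_x' by blast
next
  fix k assume k: "k \<in> {1..m}"
  have "exchanged_var n x B k \<in> laurent_on {1..n} (x' l)" if l: "l \<in> {1..m}" for l
  proof (cases "l = k")
    case True
    thus ?thesis using laurent_on_gen(1)[OF mutable[OF k], of "x' k"] by simp
  next
    case False
    \<comment> \<open>For \<open>l\<close> other than \<open>k\<close>, \<open>x k\<close> stays in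
      the cluster \<open>x' l\<close> and is invertible there, so the exchange relation at
      \<open>k\<close> can be read in that Laurent ring.\<close>
    have "inverse (x k) \<in> laurent_on {1..n} (x' l)"
      using laurent_on_gen(2)[OF mutable[OF k], of "x' l"] False by simp
    thus ?thesis using x_in_laurent_x'[OF _ l] by (intro exchanged_var_in is_subring_laurent_on)
  qed
  moreover have "exchanged_var n x B k \<in> laurent_on {1..n} x"
    by (rule exchanged_var_in[OF is_subring_laurent_on laurent_on_gen(1) laurent_on_gen(2)[OF mutable[OF k]]])
  ultimately show "exchanged_var n x B k \<in> U" unfolding U_eq by blast
next
  fix i assume i: "i \<in> {m<..n}"
  hence "i \<in> {1..n}" by auto
  hence gen: "inverse (x i) \<in> laurent_on {1..n} x" "inverse (x' k i) \<in> laurent_on {1..n} (x' k)" for k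
    by (rule laurent_on_gen)+
  have "x' k i = x i" if "k \<in> {1..m}" for k using i that by auto
  thus "inverse (x i) \<in> U" unfolding U_eq using gen by metis
qed

lemma coeff_ring_subset_L: "coeff_ring n m x \<subseteq> L"
  unfolding coeff_ring_def using L_gen(1,3)
  by (intro hull_minimal subring_L Un_least image_subsetI) auto

lemma deep_ideal_gens:
  "f \<in> lower_deep_ideal n m (x, B)" "k \<in> {1..m} \<Longrightarrow> h k \<in> lower_deep_ideal n m (x, B)"
proof -
  have "a * f + (\<Sum>i\<in>{1..m}. c i * h i) \<in> lower_deep_ideal n m (x, B)"
    if "a \<in> L" "\<And>i. i \<in> {1..m} \<Longrightarrow> c i \<in> L" for a c
    using that unfolding lower_deep_ideal_def mutable_prod_def prod.case f_def h_def L_def by blast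
  note D = this and CL = subring_closed[OF subring_L]
  show "f \<in> lower_deep_ideal n m (x, B)" using D[of 1 "\<lambda>_. 0"] CL(1,2) by simp
  assume k: "k \<in> {1..m}"
  have "(\<Sum>i\<in>{1..m}. (if i = k then 1 else 0) * h i) = h k"
    using k by (simp add: if_distrib[of "\<lambda>c. c * _"] cong: if_cong del: One_nat_def atLeastAtMost_iff)
  thus "h k \<in> lower_deep_ideal n m (x, B)" using D[of 0 "\<lambda>i. if i = k then 1 else 0"] CL(1,2) by simp
qed

lemma deep_ideal_subset_denominators:
  assumes u: "u \<in> U" and S: "is_subring S" "L \<subseteq> S"
  shows "is_ideal S hull lower_deep_ideal n m (x, B) \<subseteq> denominators S u"
proof (rule hull_minimal[of _ _ "is_ideal S", OF _ is_ideal_denominators[OF S(1)]])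
  have inv: "i \<in> {1..n} - {1..m} \<Longrightarrow> inverse (x i) \<in> L" for i using L_gen(3)[of i] by auto
  have f: "f \<in> denominators L u"
    unfolding f_def using u L_gen(1) inv x0 mutable
    by (intro prod_in_denominators[of L "{1..m}" x "{1..n}"] subring_L) (auto simp: U_eq)
  have h: "h k \<in> denominators L u" if k: "k \<in> {1..m}" for k
    unfolding h_eq[OF k]
  proof (rule prod_in_denominators[OF subring_L, of _ _ "{1..n}"])
    show "x' k i \<noteq> 0" if "i \<in> {1..m}" for i
      using independent_on_nonzero[OF indep_x'(2)[OF k] mutable[OF that]] .
    show "x' k i \<in> L" if "i \<in> {1..n} \<union> {1..m}" for i
      using that L_gen(1)[of i] L_gen(2)[OF k] mutable[of i] by auto
    show "inverse (x' k i) \<in> L" if "i \<in> {1..n} - {1..m}" for i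
      using that inv[OF that] k by auto
    show "u \<in> laurent_on {1..n} (x' k)" using u k by (simp only: U_eq)
  qed simp
  have LS: "denominators L u \<subseteq> denominators S u" using S(2) by (auto simp: denominators_def)
  note I = is_ideal_denominators[OF S(1), of u]
  have "sum g A \<in> denominators S u" if "\<And>i. i \<in> A \<Longrightarrow> g i \<in> denominators S u" for g :: "nat \<Rightarrow> 'a" and A
    using that I by (induction A rule: infinite_finite_induct) (auto simp: is_ideal_def)
  note sum = this
  show "lower_deep_ideal n m (x, B) \<subseteq> denominators S u"
  proof
    fix d assume "d \<in> lower_deep_ideal n m (x, B)"
    then obtain a c where d: "d = a * f + (\<Sum>i\<in>{1..m}. c i * h i)" and ac: "a \<in> L" "\<forall>i\<in>{1..m}. c i \<in> L"
      unfolding lower_deep_ideal_def mutable_prod_def prod.case f_def h_def L_def by blast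
    show "d \<in> denominators S u"
      unfolding d using ac f h LS S(2)
      by (intro denominators_add sum denominators_mult S(1)) blast+
  qed
qed

section \<open>The chain of deep extensions\<close>

lemma deep_extension_eq:
  "deep_extension n m (x, B) S = is_subring hull (coeff_ring n m x \<union> S \<union>
    (\<lambda>r. r * inverse f) ` saturation S ((\<lambda>s. s * f) ` S) (is_ideal S hull lower_deep_ideal n m (x, B)))"
  by (simp add: deep_extension_def Let_def mutable_prod_def f_def)

lemma deep_extension_subset_U:
  assumes S: "S \<subseteq> U"
  shows "deep_extension n m (x, B) S \<subseteq> U"
  unfolding deep_extension_eq
proof (intro hull_minimal subring_U Un_least image_subsetI S)
  show "coeff_ring n m x \<subseteq> U" using coeff_ring_subset_L L_subset_U by blast
  fix r assume r: "r \<in> saturation S ((\<lambda>s. s * f) ` S) (is_ideal S hull lower_deep_ideal n m (x, B))"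
  define u where "u = r * inverse f"
  \<comment> \<open>Dividing by \<open>f\<close> turns membership of \<open>r * g ^ k\<close> in the
    ideal generated by \<open>f\<close> into membership of \<open>u * g ^ k\<close> in
    \<open>S\<close>.\<close>
  have *: "\<exists>k. u * g ^ k \<in> U" if g: "g \<in> lower_deep_ideal n m (x, B)" for g
  proof -
    have "g \<in> is_ideal S hull lower_deep_ideal n m (x, B)" using g by (rule hull_inc)
    then obtain k s where s: "s \<in> S" "r * g ^ k = s * f"
      using r unfolding saturation_def by blast
    have "u * g ^ k = r * g ^ k * inverse f" by (simp add: u_def)
    also have "\<dots> = s" using f0 by (simp add: s(2))
    finally show ?thesis using s(1) S by blast
  qed
  have inv: "inverse (\<Prod>i\<in>{1..m}. y i) \<in> laurent_on {1..n} y" for y :: "nat \<Rightarrow> 'a"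
    unfolding prod_inversef[symmetric] comp_def
    by (intro subring_prod is_subring_laurent_on laurent_on_gen mutable)
  have "u \<in> laurent_on {1..n} x"
    using *[OF deep_ideal_gens(1)] mult_power_unit_in[OF is_subring_laurent_on _ _ f0] inv[of x]
    by (auto simp: U_eq f_def)
  moreover have "u \<in> laurent_on {1..n} (x' k)" if k: "k \<in> {1..m}" for k
    using *[OF deep_ideal_gens(2)[OF k]] mult_power_unit_in[OF is_subring_laurent_on _ _ h0[OF k]] 
      inv[of "x' k"] k unfolding h_eq[OF k] U_eq by blast
  ultimately show "r * inverse f \<in> U" by (simp add: U_eq u_def)
qed

text \<open>If \<open>g ^ k\<close> clears \<open>u\<close>, then
  \<open>u * f ^ Suc j * g ^ k\<close> is \<open>f\<close> times an element of \<open>S\<close>. The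
  exponent may depend on \<open>g\<close>, just as the saturation allows.\<close>

lemma deep_extension_lowers_power:
  assumes u: "u \<in> U" and S: "is_subring S" "L \<subseteq> S" and j: "u * f ^ Suc j \<in> S"
  shows "u * f ^ j \<in> deep_extension n m (x, B) S"
proof -
  have fS: "f \<in> S" using L_gen(1)[OF mutable] S(2) unfolding f_def by (intro subring_prod S(1)) blast
  have "\<exists>k. u * f ^ Suc j * g ^ k \<in> (\<lambda>s. s * f) ` S"
    if g: "g \<in> is_ideal S hull lower_deep_ideal n m (x, B)" for g
  proof -
    obtain k where k: "u * g ^ k \<in> S"
      using deep_ideal_subset_denominators[OF u S] g unfolding denominators_def by blast
    have "u * f ^ Suc j * g ^ k = (u * g ^ k * f ^ j) * f" by (simp add: algebra_simps)
    moreover have "u * g ^ k * f ^ j \<in> S" by (intro subring_closed(4,7)[OF S(1)] k fS)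
    ultimately show ?thesis by blast
  qed
  hence "u * f ^ Suc j \<in> saturation S ((\<lambda>s. s * f) ` S) (is_ideal S hull lower_deep_ideal n m (x, B))"
    using j by (simp add: saturation_def)
  hence "u * f ^ Suc j * inverse f \<in> deep_extension n m (x, B) S"
    unfolding deep_extension_eq by (intro hull_inc) blast
  moreover have "u * f ^ Suc j * inverse f = u * f ^ j" using f0 by simp
  ultimately show ?thesis by (simp only:)
qed

lemma U_eq_iterated_deep_extension:
  fixes S :: "nat \<Rightarrow> 'a set"
  assumes S: "S 1 = L" "\<And>i. i \<ge> 1 \<Longrightarrow> S (Suc i) = deep_extension n m (x, B) (S i)"
    and U: "fin_gen_ring U"
  shows "\<exists>i\<ge>1. U = S i"
proof -
  have sub: "is_subring (S i) \<and> L \<subseteq> S i \<and> S i \<subseteq> U" if "i \<ge> 1" for i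
    using that
  proof (induction i rule: nat_induct_at_least)
    case base
    show ?case using subring_L L_subset_U by (simp only: S) simp
  next
    case (Suc i)
    have "S i \<subseteq> deep_extension n m (x, B) (S i)"
      unfolding deep_extension_eq by (rule subset_trans[OF _ hull_subset]) blast
    thus ?case using Suc.IH deep_extension_subset_U[of "S i"] unfolding S(2)[OF Suc.hyps]
      by (auto simp: deep_extension_eq is_subring_hull)
  qed
  have mono: "S i \<subseteq> S j" if "1 \<le> i" "i \<le> j" for i j
    using that(2)
  proof (induction j rule: dec_induct)
    case (step j)
    have "S j \<subseteq> S (Suc j)"
      unfolding S(2)[OF le_trans[OF that(1) step.hyps(1)]] deep_extension_eq
      by (rule subset_trans[OF _ hull_subset]) blast
    thus ?case using step.IH by blast
  qed blast
  have "\<exists>i\<ge>1. u \<in> S i" if u: "u \<in> U" for u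
  proof -
    have "f \<in> denominators L u"
      using deep_ideal_subset_denominators[OF u subring_L] hull_inc[OF deep_ideal_gens(1)] by blast
    then obtain N where N: "u * f ^ N \<in> L" by (auto simp: denominators_def)
    \<comment> \<open>The chain starts at index 1, so \<open>k\<close> extensions lead to
      \<open>S (Suc k)\<close>, each removing one factor \<open>f\<close>.\<close>
    have "u * f ^ (N - k) \<in> S (Suc k)" if "k \<le> N" for k
      using that
    proof (induction k)
      case 0
      thus ?case using N S(1) by simp
    next
      case (Suc k)
      have "u * f ^ Suc (N - Suc k) \<in> S (Suc k)" using Suc by (simp add: Suc_diff_Suc)
      thus ?case using sub[of "Suc k"] u deep_extension_lowers_power by (simp add: S(2))
    qed
    from this[of N] show ?thesis by (intro exI[of _ "Suc N"]) simp
  qed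
  then obtain i where i: "\<And>u. u \<in> U \<Longrightarrow> i u \<ge> 1 \<and> u \<in> S (i u)" by metis
  obtain G where G: "finite G" "U = is_subring hull G" using U by (auto simp: fin_gen_ring_def)
  \<comment> \<open>The sum dominates every \<open>i g\<close>, and \<open>Suc\<close> keeps the
    index at least 1 even for empty \<open>G\<close>.\<close>
  define M where "M = Suc (\<Sum>g\<in>G. i g)"
  have "g \<in> S M" if g: "g \<in> G" for g
  proof -
    have "g \<in> U" using g unfolding G(2) by (rule hull_inc)
    moreover have "i g \<le> M" unfolding M_def using member_le_sum[OF g, of i] G(1) by simp
    ultimately show ?thesis using i mono by blast
  qed
  moreover have M: "M \<ge> 1" by (simp add: M_def)
  ultimately have "U \<subseteq> S M" unfolding G(2) using sub by (intro hull_minimal) auto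
  thus ?thesis using sub[OF M] M by blast
qed

end

theorem corollary5p2p2:
  fixes n m :: nat
    and x0 x :: "nat \<Rightarrow> 'a::field_char_0"
    and B0 B :: "nat \<Rightarrow> nat \<Rightarrow> int"
    and S :: "nat \<Rightarrow> 'a set"
  assumes "m \<le> n"
    and "ordered_seed n m (x0, B0)"
    and "totally_coprime n m (x0, B0)"
    and "(x, B) \<in> seeds_of n m (x0, B0)"
    and "S 1 = lower_bound n m (x, B)"
    and "\<And>i. i \<ge> 1 \<Longrightarrow> S (Suc i) = deep_extension n m (x, B) (S i)"
    and "fin_gen_ring (upper_cluster_algebra n m (x0, B0))"
  shows "\<exists>i\<ge>1. upper_cluster_algebra n m (x0, B0) = S i"
proof -
  note s = good_seed_if_ordered_seed[OF assms(2)] assms(3)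
  have good: "good_seed n m (x, B)" using upper_bound_seeds_of[OF s assms(1,4)] by blast
  then interpret independent_seed n m x B using assms(1) by unfold_locales
  have "upper_cluster_algebra n m (x0, B0) = U"
    unfolding U_def by (rule upper_cluster_algebra_eq_upper_bound[OF s assms(1,4)])
  thus ?thesis using U_eq_iterated_deep_extension[of S] assms(5-7) by (simp add: L_def)
qed

end
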